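(* Let $G=\langle a,w\rangle$ be a permutation group with a cyclic regular normal subgroup $W=\langle w\rangle$ of order $n$ and a cyclic point stabilizer $A=\langle a\rangle$. Let $\alpha$ be an integer such that $w^a=w^\alpha$. Then every maximal intransitive subgroup of $G$ is conjugate in $G$ to exactly one of the following maximal intransitive subgroups: (1) $M(r)=\langle a,w^r\rangle$, where $r$ is a prime divisor of $n$; (2) $P=\langle aw,w^4\rangle$, provided $a$ is a negative automorphism of $W$. In particular, $M(r)$ has $\frac{r-1}{\operatorname{ord}_r(\alpha)}$ orbits of size $\frac{n\operatorname{ord}_r(\alpha)}{r}$ and one orbit of size $\frac{n}{r}$, while $P$ has two orbits of size $\frac{n}{2}$.
   Context: All groups are finite. Since $W$ is a regular normal subgroup and $A$ a point stabilizer, $G=A\ltimes W$, and $G$ is regarded as a permutation group on the set $W$ via $u^{bv}=u^bv$ for $u,v\in W$, $b\in A$ (where $u^b=b^{-1}ub$; $A$ acts faithfully on $W$ by automorphisms). A maximal intransitive subgroup of $G$ is a subgroup that is maximal, with respect to inclusion, among the subgroups of $G$ that are not transitive on $W$. The automorphism $a$ of $W$ is negative if $4$ divides $n=|W|$ and $\alpha\equiv-1\pmod 4$, and positive otherwise. For coprime integers $m,k$, $\operatorname{ord}_m(k)$ is the multiplicative order of $k$ modulo $m$. *)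

theory Defs
  imports "HOL-Algebra.Algebra" "HOL-Number_Theory.Number_Theory"
begin

text \<open>
  A permutation group on \<open>E\<close> is a group \<open>G\<close> with a faithful action \<open>\<phi>\<close> on \<open>E\<close>
  (\<^locale>\<open>faithful_action\<close>).  The action of a group \<open>G = A \<ltimes> W\<close> on its regular normal
  subgroup \<open>W\<close> is the special case in which \<open>E\<close> is the carrier of \<open>W\<close>.

  The library's actions are left actions.  A right action \<open>x\<^sup>g\<close> is the left action
  \<open>\<phi> g x = x\<^sup>h\<close> with \<open>h = inv g\<close>; subgroups have the same orbits and point stabilizers
  for both.  Conjugation inside \<open>G\<close> is always \<open>w\<^sup>a = inv a \<otimes> w \<otimes> a\<close>.
\<close>

definition transitive_subgroup ::
  "('a, 'c) monoid_scheme \<Rightarrow> 'b set \<Rightarrow> ('a \<Rightarrow> 'b \<Rightarrow> 'b) \<Rightarrow> 'a set \<Rightarrow> bool" where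
  "transitive_subgroup G E \<phi> H \<longleftrightarrow>
     subgroup H G \<and> transitive_action (G\<lparr>carrier := H\<rparr>) E \<phi>"

definition regular_subgroup ::
  "('a, 'c) monoid_scheme \<Rightarrow> 'b set \<Rightarrow> ('a \<Rightarrow> 'b \<Rightarrow> 'b) \<Rightarrow> 'a set \<Rightarrow> bool" where
  "regular_subgroup G E \<phi> H \<longleftrightarrow>
     transitive_subgroup G E \<phi> H \<and>
     (\<forall>x\<in>E. stabilizer (G\<lparr>carrier := H\<rparr>) \<phi> x = {\<one>\<^bsub>G\<^esub>})"

definition intransitive_subgroup ::
  "('a, 'c) monoid_scheme \<Rightarrow> 'b set \<Rightarrow> ('a \<Rightarrow> 'b \<Rightarrow> 'b) \<Rightarrow> 'a set \<Rightarrow> bool" where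
  "intransitive_subgroup G E \<phi> H \<longleftrightarrow>
     subgroup H G \<and> \<not> transitive_action (G\<lparr>carrier := H\<rparr>) E \<phi>"

definition maximal_intransitive ::
  "('a, 'c) monoid_scheme \<Rightarrow> 'b set \<Rightarrow> ('a \<Rightarrow> 'b \<Rightarrow> 'b) \<Rightarrow> 'a set \<Rightarrow> bool" where
  "maximal_intransitive G E \<phi> H \<longleftrightarrow>
     intransitive_subgroup G E \<phi> H \<and>
     (\<forall>K. intransitive_subgroup G E \<phi> K \<and> H \<subseteq> K \<longrightarrow> K = H)"

definition conjugate_in :: "('a, 'c) monoid_scheme \<Rightarrow> 'a set \<Rightarrow> 'a set \<Rightarrow> bool" where
  "conjugate_in G H K \<longleftrightarrow>
     (\<exists>g\<in>carrier G. K = inv\<^bsub>G\<^esub> g <#\<^bsub>G\<^esub> H #>\<^bsub>G\<^esub> g)"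

definition orbit_sizes ::
  "('a, 'c) monoid_scheme \<Rightarrow> 'b set \<Rightarrow> ('a \<Rightarrow> 'b \<Rightarrow> 'b) \<Rightarrow> 'a set \<Rightarrow> nat multiset" where
  "orbit_sizes G E \<phi> H = image_mset card (mset_set (orbits (G\<lparr>carrier := H\<rparr>) E \<phi>))"

definition negative_aut :: "nat \<Rightarrow> int \<Rightarrow> bool" where
  "negative_aut n \<alpha> \<longleftrightarrow> 4 dvd n \<and> [\<alpha> = -1] (mod 4)"

text \<open>
  \<^const>\<open>ord\<close> is only defined for natural numbers, hence the reduction of \<open>\<alpha>\<close> modulo \<open>r\<close>.
\<close>

definition ord_int :: "nat \<Rightarrow> int \<Rightarrow> nat" where
  "ord_int r \<alpha> = ord r (nat (\<alpha> mod int r))"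

definition M_sub :: "('a, 'c) monoid_scheme \<Rightarrow> 'a \<Rightarrow> 'a \<Rightarrow> nat \<Rightarrow> 'a set" where
  "M_sub G a w r = generate G {a, w [^]\<^bsub>G\<^esub> r}"

definition P_sub :: "('a, 'c) monoid_scheme \<Rightarrow> 'a \<Rightarrow> 'a \<Rightarrow> 'a set" where
  "P_sub G a w = generate G {a \<otimes>\<^bsub>G\<^esub> w, w [^]\<^bsub>G\<^esub> (4::nat)}"

end

theory Submission
  imports Defs
begin

text \<open>
  Every element of \<open>G\<close> has the form \<open>a\<^sup>i w\<^sup>j\<close> and acts on the exponents of \<open>w\<close> modulo \<open>n\<close>
  as the affine map \<open>x \<mapsto> \<alpha>\<^sup>i x + j\<close>.  A subgroup \<open>H\<close> is generated by some \<open>a\<^sup>k w\<^sup>c\<close> and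
  \<open>H \<inter> W = \<langle>w\<^sup>d\<rangle>\<close>, so it is transitive iff \<open>T: x \<mapsto> \<beta> x + c\<close> with \<open>\<beta> = \<alpha>\<^sup>k\<close> is a single
  cycle modulo \<open>d\<close>.  By the Hull--Dobell theorem this fails only if \<open>T\<close> has a fixed point
  modulo a prime \<open>r\<close> dividing \<open>d\<close>, and then conjugating by a power of \<open>w\<close> moves that point to \<open>0\<close>
  and \<open>H\<close> into \<open>M(r)\<close>; or if \<open>4\<close> divides \<open>d\<close>, \<open>\<beta> \<equiv> -1\<close> modulo \<open>4\<close> and \<open>c\<close> is odd, and then
  \<open>a\<close> is negative and a power of \<open>w\<close> conjugates \<open>H\<close> into \<open>P\<close>.  Since no conjugate of one member of
  this family lies in another one, its members are maximal and pairwise non-conjugate.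
\<close>

section \<open>Affine maps modulo an integer\<close>

lemma common_prime_factor_int:
  fixes x :: int and d :: nat
  assumes "\<not> coprime x (int d)"
  obtains q where "Factorial_Ring.prime q" "q dvd d" "int q dvd x"
proof -
  let ?g = "nat (gcd x (int d))"
  have "?g \<noteq> 1" using assms by (auto simp: coprime_iff_gcd_eq_1)
  then obtain q where q: "Factorial_Ring.prime q" "q dvd ?g"
    using prime_factor_nat by blast
  then have "int q dvd gcd x (int d)"
    by (metis gcd_ge_0_int int_dvd_int_iff int_nat_eq)
  then show ?thesis using that q(1) by auto
qed

text \<open>Writing an exponent below \<open>p * m\<close> as \<open>k + m * i\<close> with
  \<open>k < m\<close> factors the geometric sum.\<close>

lemma sum_powers_mult:
  fixes b :: "'a::comm_semiring_1"
  shows "(\<Sum>i<p * m. b ^ i) = (\<Sum>i<m. b ^ i) * (\<Sum>i<p. (b ^ m) ^ i)"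
proof (induction p)
  case (Suc p)
  have "(\<Sum>i<Suc p * m. b ^ i) = (\<Sum>i<p * m + m. b ^ i)"
    by (simp add: add.commute)
  also have "\<dots> = (\<Sum>i<p * m. b ^ i) + b ^ (p * m) * (\<Sum>i<m. b ^ i)"
  proof -
    have "(\<Sum>i<k + m. b ^ i) = (\<Sum>i<k. b ^ i) + b ^ k * (\<Sum>i<m. b ^ i)" for k
      by (induction m) (simp_all add: distrib_left power_add add.assoc)
    then show ?thesis .
  qed
  finally show ?case
    using Suc by (simp add: distrib_left power_mult[symmetric] mult.commute)
qed simp

lemma cong_sum_powers:
  fixes b :: int
  assumes "[b = 1] (mod q)"
  shows "[(\<Sum>i<m. b ^ i) = int m] (mod q)"
proof -
  have "[(\<Sum>i<m. b ^ i) = (\<Sum>i<m. 1)] (mod q)"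
    using cong_pow[OF assms] by (intro cong_sum) simp
  then show ?thesis by simp
qed

text \<open>With \<open>b = 1 + p t\<close> the powers are \<open>1 + p t i\<close> modulo the
  square of \<open>p\<close>, so the sum is \<open>p\<close> plus \<open>p t\<close> times
  \<open>p (p - 1) / 2\<close>. For odd \<open>p\<close> the last term vanishes modulo the square.
  For \<open>p = 2\<close> it need not, hence the separate assumption modulo 4, under which the sum
  is 2 modulo 4.\<close>

lemma not_prime_square_dvd_sum_powers:
  fixes b :: int and p :: nat
  assumes p: "Factorial_Ring.prime p" and b: "[b = 1] (mod int p)"
    and b4: "p = 2 \<Longrightarrow> [b = 1] (mod 4)"
  shows "\<not> (int p)\<^sup>2 dvd (\<Sum>i<p. b ^ i)"
proof (cases "p = 2")
  case True
  have "[(\<Sum>i<p. b ^ i) = int p] (mod 4)"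
    using b4[OF True] by (rule cong_sum_powers)
  then have "4 dvd (\<Sum>i<p. b ^ i) \<longleftrightarrow> (4::int) dvd int p"
    by (rule cong_dvd_iff)
  then show ?thesis using True by simp
next
  case False
  with p have odd: "odd p" by (metis primes_dvd_imp_eq two_is_prime_nat)
  obtain t where t: "b = 1 + int p * t"
    using b by (metis cong_iff_lin cong_sym)
  have pow: "[b ^ i = 1 + int p * t * int i] (mod (int p)\<^sup>2)" for i
  proof (induction i)
    case (Suc i)
    have "[b * b ^ i = (1 + int p * t) * (1 + int p * t * int i)] (mod (int p)\<^sup>2)"
      using cong_scalar_left[OF Suc] unfolding t .
    moreover have "(1 + int p * t) * (1 + int p * t * int i) =
        (1 + int p * t * int (Suc i)) + (int p)\<^sup>2 * (t\<^sup>2 * int i)"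
      by (simp add: algebra_simps power2_eq_square)
    ultimately show ?case
      by (metis cong_add_lcancel_0 cong_mult_self_left cong_trans power_Suc)
  qed simp
  have "[(\<Sum>i<p. b ^ i) = (\<Sum>i<p. 1 + int p * t * int i)] (mod (int p)\<^sup>2)"
    using pow by (intro cong_sum)
  also have "(\<Sum>i<p. 1 + int p * t * int i) = int p + int p * t * (\<Sum>i<p. int i)"
    by (simp add: sum.distrib sum_distrib_left)
  also have "(\<Sum>i<p. int i) = int p * (int (p - 1) div 2)"
  proof -
    have "2 * (\<Sum>i<m. int i) = int m * int (m - 1)" for m
    proof (induction m)
      case (Suc m)
      then show ?case by (cases m) (simp_all add: algebra_simps)
    qed simp
    moreover have "even (int (p - 1))" using odd by simp
    then have "2 * (int p * (int (p - 1) div 2)) = int p * int (p - 1)" by simp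
    ultimately show ?thesis by (metis mult_cancel_left zero_neq_numeral)
  qed
  also have "int p + int p * t * (int p * (int (p - 1) div 2)) =
      int p + (int p)\<^sup>2 * (t * (int (p - 1) div 2))"
    by (simp add: power2_eq_square)
  also have "[\<dots> = int p] (mod (int p)\<^sup>2)"
    by (simp add: cong_iff_dvd_diff)
  finally have "(int p)\<^sup>2 dvd (\<Sum>i<p. b ^ i) \<longleftrightarrow> (int p)\<^sup>2 dvd int p"
    by (rule cong_dvd_iff)
  moreover have "\<not> (int p)\<^sup>2 dvd int p"
    using prime_gt_1_nat[OF p] by (simp add: power2_eq_square)
  ultimately show ?thesis by simp
qed

text \<open>The hard half of the Hull--Dobell theorem on full periods of \<open>x \<mapsto> b x + c\<close> modulo \<open>d\<close>.\<close>

lemma dvd_of_dvd_sum_powers: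
  fixes b :: int and d m :: nat
  assumes "0 < d"
    and "\<And>q. Factorial_Ring.prime q \<Longrightarrow> q dvd d \<Longrightarrow> [b = 1] (mod int q)"
    and "4 dvd d \<Longrightarrow> [b = 1] (mod 4)"
    and "int d dvd (\<Sum>i<m. b ^ i)"
  shows "d dvd m"
  using assms
proof (induction d arbitrary: m rule: less_induct)
  case (less d)
  show ?case
  proof (cases "d = 1")
    case False
    then obtain p where p: "Factorial_Ring.prime p" "p dvd d"
      using prime_factor_nat by blast
    from p(2) obtain d' where d: "d = p * d'" ..
    have b: "[b = 1] (mod int p)" using less.prems(2) p by blast
    have "int p dvd (\<Sum>i<m. b ^ i)"
      using less.prems(4) d by (metis dvd_mult_left of_nat_mult)
    then have "p dvd m"
      using cong_dvd_iff[OF cong_sum_powers[OF b, of m]] by simp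
    then obtain m' where m: "m = p * m'" ..
    \<comment> \<open>By \<open>sum_powers_mult\<close> the sum for \<open>m\<close> is the sum for
      \<open>m'\<close> times \<open>?u\<close>. Removing one factor \<open>p\<close> from
      \<open>d\<close> and from \<open>?u\<close> reduces the claim to \<open>d'\<close> and
      \<open>m'\<close>.\<close>
    let ?u = "\<Sum>i<p. (b ^ m') ^ i"
    have "int p dvd ?u"
      using cong_dvd_iff[OF cong_sum_powers[of "b ^ m'" "int p" p]] cong_pow[OF b, of m'] by simp
    then obtain v where v: "?u = int p * v" ..
    have "int p * int d' dvd (\<Sum>i<m'. b ^ i) * (int p * v)"
      using less.prems(4) unfolding d m sum_powers_mult v by simp
    then have "int d' dvd (\<Sum>i<m'. b ^ i) * v"
      using prime_gt_0_nat[OF p(1)] by (simp add: mult.left_commute)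
    \<comment> \<open>A common prime \<open>q\<close> is excluded in two ways: \<open>q = p\<close>
      would put the square of \<open>p\<close> into \<open>?u\<close>, while for \<open>q\<close>
      different from \<open>p\<close> the sum \<open>?u\<close> is \<open>p\<close> modulo
      \<open>q\<close>, a unit.\<close>
    moreover have "coprime (int d') v"
    proof (rule ccontr)
      assume "\<not> coprime (int d') v"
      then obtain q where q: "Factorial_Ring.prime q" "q dvd d'" and qv: "int q dvd v"
        using common_prime_factor_int by (metis coprime_commute)
      have bq: "[b = 1] (mod int q)" using less.prems(2) q d by simp
      show False
      proof (cases "q = p")
        case True
        have "\<not> (int p)\<^sup>2 dvd ?u"
        proof (rule not_prime_square_dvd_sum_powers[OF p(1)])
          show "[b ^ m' = 1] (mod int p)" using cong_pow[OF b, of m'] by simp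
          assume "p = 2"
          \<comment> \<open>Here \<open>q = p = 2\<close> still divides \<open>d'\<close>, so 4
            divides \<open>d = p * d'\<close>.\<close>
          then have "[b = 1] (mod 4)" using less.prems(3) q True d by auto
          from cong_pow[OF this, of m'] show "[b ^ m' = 1] (mod 4)" by simp
        qed
        moreover have "(int p)\<^sup>2 dvd ?u"
          using qv True unfolding v power2_eq_square by simp
        ultimately show False by simp
      next
        case False
        have "int q dvd ?u" using qv unfolding v by simp
        then have "q dvd p"
          using cong_dvd_iff[OF cong_sum_powers[of "b ^ m'" "int q" p]] cong_pow[OF bq, of m'] by simp
        with False p q show False by (simp add: primes_dvd_imp_eq)
      qed
    qed
    ultimately have "int d' dvd (\<Sum>i<m'. b ^ i)"
      by (simp add: coprime_dvd_mult_left_iff)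
    moreover have d': "0 < d'" using less.prems(1) unfolding d by simp
    moreover have "d' < d" using d' prime_gt_1_nat[OF p(1)] unfolding d by simp
    moreover have "[b = 1] (mod int q)" if "Factorial_Ring.prime q" "q dvd d'" for q
      using less.prems(2)[OF that(1)] that(2) unfolding d by simp
    moreover have "[b = 1] (mod 4)" if "4 dvd d'"
      using less.prems(3) that unfolding d by simp
    ultimately have "d' dvd m'" by (intro less.IH)
    then show ?thesis unfolding d m by simp
  qed simp
qed

text \<open>\<open>c * (\<Sum>i<m. b ^ i)\<close> is the \<open>m\<close>-th iterate of 0 under
  \<open>x \<mapsto> b * x + c\<close>. Iterates \<open>i < j\<close> differ by
  \<open>c * b ^ i\<close> times the sum of length \<open>j - i\<close>. Since \<open>b\<close> and
  \<open>c\<close> are units modulo \<open>d\<close>, \<open>dvd_of_dvd_sum_powers\<close> makes the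
  first \<open>d\<close> iterates distinct, and by counting they exhaust all residues.\<close>

lemma affine_orbit_exhaustive:
  fixes b c y :: int and d :: nat
  assumes d: "0 < d" and c: "coprime c (int d)"
    and prm: "\<And>q. Factorial_Ring.prime q \<Longrightarrow> q dvd d \<Longrightarrow> [b = 1] (mod int q)"
    and four: "4 dvd d \<Longrightarrow> [b = 1] (mod 4)"
  obtains m where "[y = c * (\<Sum>i<m. b ^ i)] (mod int d)"
proof -
  let ?T = "\<lambda>m. c * (\<Sum>i<m. b ^ i) mod int d"
  have b: "coprime b (int d)"
  proof (rule ccontr)
    assume "\<not> coprime b (int d)"
    then obtain q where q: "Factorial_Ring.prime q" "q dvd d" "int q dvd b"
      by (rule common_prime_factor_int)
    then have "int q dvd 1" using cong_dvd_iff[OF prm[OF q(1,2)]] by blast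
    with q(1) show False by simp
  qed
  have neq: "?T i \<noteq> ?T j" if "i < j" "j < d" for i j
  proof
    assume "?T i = ?T j"
    then have "int d dvd c * (\<Sum>k<j. b ^ k) - c * (\<Sum>k<i. b ^ k)"
      by (metis mod_eq_dvd_iff)
    also have "(\<Sum>k<j. b ^ k) = (\<Sum>k<i. b ^ k) + b ^ i * (\<Sum>k<j - i. b ^ k)"
    proof -
      have "(\<Sum>k<i + l. b ^ k) = (\<Sum>k<i. b ^ k) + b ^ i * (\<Sum>k<l. b ^ k)" for l
        by (induction l) (simp_all add: distrib_left power_add)
      from this[of "j - i"] show ?thesis using that by simp
    qed
    finally have "int d dvd (c * b ^ i) * (\<Sum>k<j - i. b ^ k)"
      by (simp add: algebra_simps)
    then have "int d dvd (\<Sum>k<j - i. b ^ k)"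
      using b c by (subst (asm) coprime_dvd_mult_right_iff) (simp_all add: coprime_commute)
    then have "d dvd j - i"
      using d prm four by (intro dvd_of_dvd_sum_powers[of d b]) auto
    with that show False by (auto dest: dvd_imp_le)
  qed
  then have "inj_on ?T {..<d}"
    by (metis (no_types, lifting) inj_onI lessThan_iff linorder_neqE_nat)
  then have "card (?T ` {..<d}) = card {0..<int d}" by (simp add: card_image)
  moreover have "?T ` {..<d} \<subseteq> {0..<int d}" using d by auto
  ultimately have "?T ` {..<d} = {0..<int d}"
    by (intro card_subset_eq) auto
  moreover have "y mod int d \<in> {0..<int d}" using d by simp
  ultimately obtain m where "y mod int d = ?T m" by (metis (no_types, lifting) imageE)
  then show ?thesis using that by (simp add: cong_def)
qed

section \<open>Subgroups of the integers, residue classes, and residues modulo a prime and 4\<close>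

lemma int_subgroup_multiples:
  fixes S :: "int set"
  assumes "x \<in> S" "0 < x" and diff: "\<And>x y. x \<in> S \<Longrightarrow> y \<in> S \<Longrightarrow> x - y \<in> S"
  obtains d :: nat where "0 < d" "\<And>y. y \<in> S \<longleftrightarrow> int d dvd y"
proof -
  let ?P = "\<lambda>k::nat. 0 < k \<and> int k \<in> S"
  \<comment> \<open>The generator is the least positive element; division with remainder shows that
    it divides every other element.\<close>
  define d where "d = (LEAST k. ?P k)"
  have "?P (nat x)" using assms by simp
  then have d: "0 < d" "int d \<in> S" using LeastI[of ?P] unfolding d_def by blast+
  have zero: "0 \<in> S" using diff[OF d(2) d(2)] by simp
  have neg: "- y \<in> S" if "y \<in> S" for y using diff[OF zero that] by simp
  have nat_mult: "int k * int d \<in> S" for k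
  proof (induction k)
    case (Suc k)
    from diff[OF Suc neg[OF d(2)]] show ?case by (simp add: algebra_simps)
  qed (use zero in simp)
  have mult: "k * int d \<in> S" for k
  proof (cases k rule: int_cases2)
    case (nonneg n) then show ?thesis using nat_mult by simp
  next
    case (nonpos n) then show ?thesis using neg[OF nat_mult[of n]] by simp
  qed
  have "int d dvd y" if "y \<in> S" for y
  proof (rule ccontr)
    assume ndvd: "\<not> int d dvd y"
    have "y mod int d \<in> S"
      using diff[OF that mult[of "y div int d"]] by (simp add: minus_div_mult_eq_mod)
    moreover have "y mod int d \<noteq> 0" using ndvd by (metis dvd_eq_mod_eq_0)
    moreover have "0 \<le> y mod int d" using d(1) by simp
    ultimately have "?P (nat (y mod int d))" by auto
    then have "d \<le> nat (y mod int d)" unfolding d_def by (rule Least_le)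
    moreover have "y mod int d < int d" using d(1) by simp
    ultimately show False using d(1) by linarith
  qed
  moreover have "y \<in> S" if "int d dvd y" for y
    using that mult by (auto simp: dvd_def mult.commute)
  ultimately show ?thesis using that d(1) by blast
qed

text \<open>Each \<open>y\<close> corresponds to its remainder and quotient by \<open>r\<close>; the
  quotients run freely over \<open>n div r\<close> values because \<open>r\<close> divides
  \<open>n\<close>.\<close>

lemma card_residues_in:
  fixes r n :: nat
  assumes "r dvd n" "0 < r" "S \<subseteq> {0..<int r}"
  shows "card {y \<in> {0..<int n}. y mod int r \<in> S} = card S * (n div r)"
proof -
  have n: "int n = int (n div r) * int r"
    using assms(1) by (metis dvd_div_mult_self of_nat_mult)
  have "bij_betw (\<lambda>(s, t). s + int r * t) (S \<times> {0..<int (n div r)})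
      {y \<in> {0..<int n}. y mod int r \<in> S}"
  proof (rule bij_betw_byWitness[where f' = "\<lambda>y. (y mod int r, y div int r)"])
    show "(\<lambda>(s, t). s + int r * t) ` (S \<times> {0..<int (n div r)})
        \<subseteq> {y \<in> {0..<int n}. y mod int r \<in> S}"
    proof clarsimp
      fix s t assume st: "s \<in> S" "0 \<le> t" "t < int (n div r)"
      then have s: "0 \<le> s" "s < int r" using assms by auto
      have "s + int r * t < int r * (t + 1)" using s by (simp add: algebra_simps)
      also have "\<dots> \<le> int r * int (n div r)" using st by (intro mult_left_mono) auto
      also have "\<dots> = int n" using n by (simp add: mult.commute)
      finally show "0 \<le> s + int r * t \<and> s + int r * t < int n \<and> s mod int r \<in> S"
        using s st by simp
    qed
    show "(\<lambda>y. (y mod int r, y div int r)) ` {y \<in> {0..<int n}. y mod int r \<in> S}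
        \<subseteq> S \<times> {0..<int (n div r)}"
    proof (intro image_subsetI)
      fix y assume "y \<in> {y \<in> {0..<int n}. y mod int r \<in> S}"
      then have y: "0 \<le> y" "y < int n" "y mod int r \<in> S" by auto
      have "int r * (y div int r) \<le> y"
        using assms(2) mult_div_mod_eq[of "int r" y] pos_mod_sign[of "int r" y] by linarith
      with y n have "int r * (y div int r) < int r * int (n div r)"
        by (simp add: mult.commute)
      then have "y div int r < int (n div r)" using assms(2) by simp
      with y assms(2) show "(y mod int r, y div int r) \<in> S \<times> {0..<int (n div r)}"
        by (simp add: pos_imp_zdiv_nonneg_iff del: of_nat_div)
    qed
  qed (use assms in auto)
  then have "card {y \<in> {0..<int n}. y mod int r \<in> S} = card (S \<times> {0..<int (n div r)})"
    by (simp add: bij_betw_same_card)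
  then show ?thesis by (simp add: card_cartesian_product)
qed

text \<open>The factor \<open>x\<close> is a unit modulo \<open>r\<close> and cancels, so the values
  repeat exactly as the powers of \<open>\<alpha>\<close> do, with period the order of
  \<open>\<alpha>\<close>.\<close>

lemma card_power_orbit_mod_prime:
  fixes r :: nat and x \<alpha> :: int
  assumes r: "Factorial_Ring.prime r" and \<alpha>: "coprime \<alpha> (int r)" and x: "\<not> int r dvd x"
  shows "card (range (\<lambda>i::nat. \<alpha> ^ i * x mod int r)) = ord_int r \<alpha>" and "0 < ord_int r \<alpha>"
proof -
  define b where "b = nat (\<alpha> mod int r)"
  have r0: "0 < r" using r by (simp add: prime_gt_0_nat)
  have b: "[\<alpha> = int b] (mod int r)" using r0 unfolding b_def by (simp add: cong_def)
  have "coprime (int b) (int r)"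
    using \<alpha> b by (metis cong_imp_coprime)
  then have cb: "coprime r b" by (simp add: coprime_commute)
  have xr: "coprime x (int r)"
    using r x by (metis coprime_commute prime_imp_coprime prime_int_nat_transfer of_nat_0_le_iff nat_int)
  have iff: "\<alpha> ^ i * x mod int r = \<alpha> ^ j * x mod int r \<longleftrightarrow> [i = j] (mod ord r b)" for i j
  proof -
    have "\<alpha> ^ i * x mod int r = \<alpha> ^ j * x mod int r \<longleftrightarrow> [\<alpha> ^ i = \<alpha> ^ j] (mod int r)"
      using cong_mult_rcancel[OF xr] by (simp add: cong_def)
    also have "\<dots> \<longleftrightarrow> [int b ^ i = int b ^ j] (mod int r)"
      using cong_pow[OF b] by (metis cong_sym cong_trans)
    also have "\<dots> \<longleftrightarrow> [b ^ i = b ^ j] (mod r)"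
      by (simp flip: of_nat_power add: cong_int_iff)
    also have "\<dots> \<longleftrightarrow> [i = j] (mod ord r b)"
      using cb by (rule order_divides_expdiff)
    finally show ?thesis .
  qed
  show pos: "0 < ord_int r \<alpha>" using cb unfolding ord_int_def b_def[symmetric] by simp
  have "bij_betw (\<lambda>i. \<alpha> ^ i * x mod int r) {..<ord r b} (range (\<lambda>i::nat. \<alpha> ^ i * x mod int r))"
  proof (intro bij_betw_imageI inj_onI)
    fix i j assume "i \<in> {..<ord r b}" "j \<in> {..<ord r b}"
      "\<alpha> ^ i * x mod int r = \<alpha> ^ j * x mod int r"
    then show "i = j" unfolding iff by (simp add: cong_def)
  next
    show "(\<lambda>i. \<alpha> ^ i * x mod int r) ` {..<ord r b} = range (\<lambda>i::nat. \<alpha> ^ i * x mod int r)"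
    proof (intro equalityI subsetI)
      fix y assume "y \<in> range (\<lambda>i::nat. \<alpha> ^ i * x mod int r)"
      then obtain i where "y = \<alpha> ^ i * x mod int r" by blast
      also have "\<dots> = \<alpha> ^ (i mod ord r b) * x mod int r"
        unfolding iff by (simp add: cong_def)
      finally show "y \<in> (\<lambda>i. \<alpha> ^ i * x mod int r) ` {..<ord r b}"
        using pos unfolding ord_int_def b_def[symmetric] by auto
    qed auto
  qed
  then show "card (range (\<lambda>i::nat. \<alpha> ^ i * x mod int r)) = ord_int r \<alpha>"
    unfolding ord_int_def b_def[symmetric] by (metis bij_betw_same_card card_lessThan)
qed

text \<open>\<open>b - 1\<close> is invertible modulo the prime, and the fixed point is
  \<open>- c\<close> times its inverse.\<close>

lemma affine_fixed_point_mod_prime: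
  fixes b c :: int and r :: nat
  assumes "Factorial_Ring.prime r" "\<not> [b = 1] (mod int r)"
  shows "\<exists>x. [b * x + c = x] (mod int r)"
proof -
  have "coprime (b - 1) (int r)"
    using assms by (metis cong_iff_dvd_diff coprime_commute prime_imp_coprime prime_nat_int_transfer)
  then obtain x where "[(b - 1) * x = 1] (mod int r)"
    by (metis cong_solve_coprime_int)
  then have "int r dvd (b - 1) * x - 1" by (simp add: cong_iff_dvd_diff)
  then have "int r dvd (- c) * ((b - 1) * x - 1)" by (rule dvd_mult)
  also have "(- c) * ((b - 1) * x - 1) = (b * (- c * x) + c) - (- c * x)"
    by (simp add: algebra_simps)
  finally show ?thesis unfolding cong_iff_dvd_diff ..
qed

lemma odd_cong_4:
  fixes x :: int
  assumes "odd x"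
  shows "[x = 1] (mod 4) \<or> [x = -1] (mod 4)"
proof -
  obtain m where m: "x = 2 * m + 1" using assms by (rule oddE)
  show ?thesis
  proof (cases "even m")
    case True
    then have "[x = 1] (mod 4)" unfolding cong_iff_dvd_diff m by (auto elim!: evenE)
    then show ?thesis ..
  next
    case False
    then obtain t where "m = 2 * t + 1" by (rule oddE)
    then have "x - (-1) = 4 * (t + 1)" using m by simp
    then have "[x = -1] (mod 4)" unfolding cong_iff_dvd_diff by (metis dvd_triv_left)
    then show ?thesis ..
  qed
qed

section \<open>Coordinates on the group and on the points\<close>

text \<open>The inverse of \<open>x\<close> is the power of exponent \<open>order G - 1\<close>.
  This spares closure under inverses for sets described by natural exponents of
  \<open>a\<close>.\<close>

lemma (in group) finite_submonoid_subgroup: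
  assumes "finite (carrier G)" "submonoid H G"
  shows "subgroup H G"
proof (rule submonoid_subgroupI[OF assms(2)])
  interpret H: submonoid H G by fact
  fix x assume x: "x \<in> H"
  have pow: "x [^] k \<in> H" for k :: nat
    using x by (induction k) auto
  have "0 < order G" using assms(1) by (simp add: order_gt_0_iff_finite)
  then have "x [^] (order G - 1) \<otimes> x = \<one>"
    using x pow_order_eq_1[of x] by (metis H.mem_carrier Suc_diff_1 nat_pow_Suc)
  then have "inv x = x [^] (order G - 1)"
    using x by (intro inv_equality) auto
  then show "inv x \<in> H" using pow by simp
qed

locale cyclic_regular = group_action G E \<phi>
  for G :: "('a, 'm) monoid_scheme" (structure) and E :: "'b set" and \<phi> +
  fixes a w p W n \<alpha>
  assumes finite_carrier: "finite (carrier G)"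
    and a [simp, intro]: "a \<in> carrier G" and w [simp, intro]: "w \<in> carrier G"
    and carrier_eq: "carrier G = generate G {a, w}"
    and W_eq: "W = generate G {w}"
    and regular: "regular_subgroup G E \<phi> W"
    and n_eq: "n = card W"
    and p [simp, intro]: "p \<in> E"
    and stabilizer_p: "generate G {a} = stabilizer G \<phi> p"
    and conj_w: "inv a \<otimes> w \<otimes> a = w [^] (\<alpha>::int)"
begin

sublocale group G
  using group_hom by (rule group_hom.axioms(1))

text \<open>The exponent of \<open>a\<close> is natural so that \<open>\<alpha> ^ i\<close> is an
  integer; the exponent of \<open>w\<close> may be any integer. The coordinates are not unique:
  \<open>j\<close> counts only modulo \<open>n\<close>, and \<open>i\<close> only through the power
  of \<open>a\<close>.\<close>

definition el :: "nat \<Rightarrow> int \<Rightarrow> 'a" where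
  "el i j = a [^] i \<otimes> w [^] j"

lemma el_closed [simp, intro]: "el i j \<in> carrier G"
  by (simp add: el_def)

lemma el_w: "el 0 j = w [^] j"
  by (simp add: el_def)

lemma el_a: "el i 0 = a [^] i"
  by (simp add: el_def)

text \<open>Conjugation by \<open>a\<close> is an endomorphism, so its value on \<open>w\<close>
  determines it on all powers of \<open>w\<close>.\<close>

lemma w_pow_mult_a: "w [^] (j::int) \<otimes> a = a \<otimes> w [^] (\<alpha> * j)"
proof -
  have "a \<otimes> (inv a \<otimes> x) = x" if "x \<in> carrier G" for x
    using that by (simp flip: m_assoc)
  then have "(\<lambda>x. inv a \<otimes> x \<otimes> a) \<in> hom G G"
    by (auto simp: hom_def m_assoc)
  then have "inv a \<otimes> w [^] j \<otimes> a = (inv a \<otimes> w \<otimes> a) [^] j"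
    using hom_int_pow[OF _ w is_group is_group] by fast
  then have "inv a \<otimes> (w [^] j \<otimes> a) = w [^] (\<alpha> * j)"
    by (simp add: conj_w int_pow_pow m_assoc)
  then show ?thesis by (simp add: inv_solve_left')
qed

lemma w_pow_mult_a_pow: "w [^] (j::int) \<otimes> a [^] (i::nat) = a [^] i \<otimes> w [^] (\<alpha> ^ i * j)"
proof (induction i)
  case (Suc i)
  have "w [^] j \<otimes> a [^] Suc i = (w [^] j \<otimes> a [^] i) \<otimes> a"
    by (simp add: m_assoc)
  also have "\<dots> = a [^] i \<otimes> (w [^] (\<alpha> ^ i * j) \<otimes> a)"
    by (simp add: Suc m_assoc)
  also have "\<dots> = a [^] Suc i \<otimes> w [^] (\<alpha> ^ Suc i * j)"
    by (simp add: w_pow_mult_a m_assoc mult.assoc)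
  finally show ?case .
qed simp

lemma el_mult: "el i j \<otimes> el k l = el (i + k) (\<alpha> ^ k * j + l)"
proof -
  have "el i j \<otimes> el k l = a [^] i \<otimes> (w [^] j \<otimes> a [^] k) \<otimes> w [^] l"
    by (simp add: el_def m_assoc)
  also have "\<dots> = (a [^] i \<otimes> a [^] k) \<otimes> (w [^] (\<alpha> ^ k * j) \<otimes> w [^] l)"
    by (simp add: w_pow_mult_a_pow m_assoc)
  finally show ?thesis
    by (simp add: el_def nat_pow_mult int_pow_mult)
qed

text \<open>The new exponent of \<open>w\<close> is the displacement of \<open>x\<close> under the
  affine map of \<open>el i j\<close>. Fixed points thus become divisibility conditions on
  exponents.\<close>

lemma conj_el: "w [^] x \<otimes> el i j \<otimes> inv (w [^] x) = el i (\<alpha> ^ i * x + j - x)"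
proof -
  have "inv (w [^] x) = el 0 (- x)" by (simp add: el_w int_pow_neg)
  then show ?thesis by (simp add: el_mult flip: el_w)
qed

text \<open>Finiteness of \<open>G\<close> reduces the subgroup property to closure under products.
  \<open>Q\<close> may depend on the chosen coordinates: an element belongs to the set as soon as
  one of its coordinate pairs satisfies \<open>Q\<close>.\<close>

lemma subgroup_el_set:
  assumes "Q 0 0" and closed: "\<And>i j k l. Q i j \<Longrightarrow> Q k l \<Longrightarrow> Q (i + k) (\<alpha> ^ k * j + l)"
  shows "subgroup {g. \<exists>i j. g = el i j \<and> Q i j} G" (is "subgroup ?S G")
proof (rule finite_submonoid_subgroup[OF finite_carrier])
  show "submonoid ?S G"
  proof (rule submonoid.intro)
    have "\<one> = el 0 0" by (simp add: el_def)
    with assms(1) show "\<one> \<in> ?S" by blast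
    fix x y assume "x \<in> ?S" "y \<in> ?S"
    then obtain i j k l where "x = el i j" "Q i j" "y = el k l" "Q k l" by blast
    with closed show "x \<otimes> y \<in> ?S" unfolding mem_Collect_eq by (metis el_mult)
  qed auto
qed

lemma generate_subset_el_set:
  assumes "Q 0 0" and "\<And>i j k l. Q i j \<Longrightarrow> Q k l \<Longrightarrow> Q (i + k) (\<alpha> ^ k * j + l)"
    and "x = el i j" "Q i j" "y = el k l" "Q k l"
  shows "generate G {x, y} \<subseteq> {g. \<exists>i j. g = el i j \<and> Q i j}"
  using assms by (intro generate_subgroup_incl subgroup_el_set) blast+

lemma carrier_el: "g \<in> carrier G \<Longrightarrow> \<exists>i j. g = el i j"
proof -
  have "a = el 1 0" "w = el 0 1" by (simp_all add: el_def)
  then show "g \<in> carrier G \<Longrightarrow> \<exists>i j. g = el i j"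
    unfolding carrier_eq using generate_subset_el_set[of "\<lambda>_ _. True"] by blast
qed

lemma W_el: "W = range (el 0)"
  unfolding W_eq generate_pow[OF w] by (auto simp: el_w)

lemma n_pos: "0 < n"
proof -
  have "finite W" unfolding W_el by (rule finite_subset[OF _ finite_carrier]) auto
  moreover have "W \<noteq> {}" unfolding W_el by simp
  ultimately show ?thesis unfolding n_eq by (simp add: card_gt_0_iff)
qed

lemma w_pow_eq_one_iff: "w [^] (j::int) = \<one> \<longleftrightarrow> int n dvd j"
  using generate_pow_card[OF w] unfolding n_eq W_eq by (simp add: int_pow_eq_id)

lemma w_pow_eq_iff: "w [^] (j::int) = w [^] k \<longleftrightarrow> [j = k] (mod int n)"
  using generate_pow_card[OF w] unfolding n_eq W_eq
  by (simp add: int_pow_eq cong_iff_dvd_diff dvd_diff_commute)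

section \<open>Regularity of \<open>W\<close>: comparison of coordinates and labelling of the
  points\<close>

lemma W_transitive: "transitive_action (G\<lparr>carrier := W\<rparr>) E \<phi>"
  using regular by (simp add: regular_subgroup_def transitive_subgroup_def)

lemma W_fixed_point_free: "g \<in> W \<Longrightarrow> \<phi> g p = p \<Longrightarrow> g = \<one>"
  using regular p unfolding regular_subgroup_def stabilizer_def by auto

lemma a_pow_stabilizes: "\<phi> (a [^] (i::nat)) p = p"
proof -
  have "subgroup (generate G {a}) G" by (simp add: generate_is_subgroup)
  moreover have "a \<in> generate G {a}" by (simp add: generate.incl)
  ultimately have "a [^] i \<in> generate G {a}"
    by (metis int_pow_int subgroup_int_pow_closed)
  then show ?thesis unfolding stabilizer_p stabilizer_def by simp
qed

lemma inv_a_pow_stabilizes: "\<phi> (inv (a [^] (i::nat))) p = p"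
  using stabilizer_m_inv_closed[OF p, of "a [^] i"] a_pow_stabilizes
  by (simp add: stabilizer_def)

text \<open>The quotient \<open>?g\<close> of the two powers of \<open>a\<close> fixes
  \<open>p\<close> and is also a power of \<open>w\<close>; regularity of \<open>W\<close> makes it
  trivial.\<close>

lemma el_eqD:
  assumes "el i j = el k l"
  shows "[j = l] (mod int n)" and "a [^] i = a [^] k"
proof -
  let ?g = "inv (a [^] k) \<otimes> a [^] i"
  have "a [^] i \<otimes> w [^] j \<otimes> w [^] (- j) = a [^] k \<otimes> w [^] l \<otimes> w [^] (- j)"
    using assms by (simp add: el_def)
  then have "a [^] i = a [^] k \<otimes> w [^] (l - j)"
    by (simp add: m_assoc int_pow_mult[symmetric])
  then have g: "?g = w [^] (l - j)"
    by (simp flip: m_assoc)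
  moreover have "\<phi> ?g p = p"
    by (simp add: composition_rule a_pow_stabilizes inv_a_pow_stabilizes)
  moreover have "w [^] (l - j) \<in> W" by (auto simp: W_el el_w)
  ultimately have one: "w [^] (l - j) = \<one>" using W_fixed_point_free by metis
  then show "[j = l] (mod int n)"
    unfolding w_pow_eq_one_iff by (metis cong_iff_dvd_diff cong_sym)
  show "a [^] i = a [^] k"
    using one \<open>a [^] i = a [^] k \<otimes> w [^] (l - j)\<close> by simp
qed

lemma el_cong: "[j = l] (mod int n) \<Longrightarrow> el i j = el i l"
  unfolding el_def by (simp flip: w_pow_eq_iff)

text \<open>Moving \<open>w\<close> to the right past equal powers of \<open>a\<close> produces the
  exponents \<open>\<alpha> ^ i\<close> and \<open>\<alpha> ^ k\<close>, which must agree modulo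
  \<open>n\<close>.\<close>

lemma \<alpha>_pow_cong:
  assumes "a [^] i = a [^] (k::nat)"
  shows "[\<alpha> ^ i = \<alpha> ^ k] (mod int n)"
proof -
  have "el 0 1 \<otimes> el i 0 = el 0 1 \<otimes> el k 0"
    using assms by (simp add: el_a)
  then show ?thesis by (auto simp: el_mult dest: el_eqD(1))
qed

lemma coprime_\<alpha>: "coprime \<alpha> (int n)"
proof -
  have o: "0 < order G" using finite_carrier by (simp add: order_gt_0_iff_finite)
  have "[\<alpha> ^ order G = \<alpha> ^ 0] (mod int n)"
    by (rule \<alpha>_pow_cong) (simp add: pow_order_eq_1)
  then have "coprime (\<alpha> ^ order G) (int n)"
    by (metis cong_imp_coprime cong_sym coprime_1_left power_0)
  then show ?thesis using o by (simp add: coprime_power_left_iff)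
qed

text \<open>
  The inverse turns the left action \<open>\<phi>\<close> into the right action \<open>x \<mapsto> \<alpha>\<^sup>i x + j\<close> on exponents.
\<close>

definition pt :: "int \<Rightarrow> 'b" where
  "pt x = \<phi> (inv (w [^] x)) p"

lemma pt_closed [simp, intro]: "pt x \<in> E"
  unfolding pt_def by (rule element_image[OF _ p refl]) simp

lemma action_pt: "\<phi> (inv (el i j)) (pt x) = pt (\<alpha> ^ i * x + j)"
proof -
  have "\<phi> (inv (el i j)) (pt x) = \<phi> (inv (el i j) \<otimes> inv (el 0 x)) p"
    unfolding pt_def by (simp add: composition_rule el_w)
  also have "inv (el i j) \<otimes> inv (el 0 x) = inv (el 0 x \<otimes> el i j)"
    by (simp add: inv_mult_group)
  also have "el 0 x \<otimes> el i j = a [^] i \<otimes> w [^] (\<alpha> ^ i * x + j)"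
    by (simp add: el_mult) (simp add: el_def)
  also have "\<phi> (inv (a [^] i \<otimes> w [^] (\<alpha> ^ i * x + j))) p = pt (\<alpha> ^ i * x + j)"
    unfolding pt_def by (simp add: inv_mult_group composition_rule inv_a_pow_stabilizes)
  finally show ?thesis .
qed

text \<open>Translation by \<open>- y\<close> turns equality of the points into
  \<open>w [^] (y - x)\<close> fixing \<open>p\<close>, which regularity allows only for the
  identity.\<close>

lemma pt_eq_iff: "pt x = pt y \<longleftrightarrow> [x = y] (mod int n)"
proof
  assume eq: "pt x = pt y"
  have "pt (x - y) = \<phi> (inv (el 0 (- y))) (pt x)" by (simp add: action_pt)
  also have "\<dots> = pt 0" by (simp add: eq action_pt)
  also have "\<dots> = p" using p by (simp add: pt_def flip: id_eq_one)
  finally have "\<phi> (w [^] (y - x)) p = p"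
    by (simp add: pt_def flip: int_pow_neg)
  moreover have "w [^] (y - x) \<in> W" by (auto simp: W_el el_w)
  ultimately have "w [^] (y - x) = \<one>" by (rule W_fixed_point_free[rotated])
  then show "[x = y] (mod int n)"
    unfolding w_pow_eq_one_iff by (metis cong_iff_dvd_diff cong_sym)
next
  assume "[x = y] (mod int n)"
  then show "pt x = pt y" unfolding pt_def by (simp flip: w_pow_eq_iff)
qed

lemma E_eq: "E = range pt"
proof -
  have "\<exists>x. y = pt x" if y: "y \<in> E" for y
  proof -
    obtain g where "g \<in> W" "\<phi> g p = y"
      using transitive_action.unique_orbit[OF W_transitive p y] by auto
    then obtain j :: int where "y = \<phi> (w [^] j) p" by (auto simp: W_el el_w)
    then have "y = pt (- j)" unfolding pt_def by (simp add: int_pow_neg)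
    then show ?thesis ..
  qed
  then show ?thesis by auto
qed

lemma bij_pt: "bij_betw pt {0..<int n} E"
proof (intro bij_betw_imageI inj_onI)
  fix x y assume "x \<in> {0..<int n}" "y \<in> {0..<int n}" "pt x = pt y"
  then show "x = y" by (auto simp: pt_eq_iff cong_def)
next
  have "pt x \<in> pt ` {0..<int n}" for x
  proof
    show "pt x = pt (x mod int n)" by (simp add: pt_eq_iff cong_def)
    show "x mod int n \<in> {0..<int n}" using n_pos by simp
  qed
  then show "pt ` {0..<int n} = E" unfolding E_eq by blast
qed

text \<open>Since \<open>H\<close> is closed under inverses, its orbits may be computed with the
  elements \<open>inv (el i j)\<close>, for which \<open>action_pt\<close> supplies the affine
  formula.\<close>

lemma orbit_pt:
  assumes "subgroup H G"
  shows "orbit (G\<lparr>carrier := H\<rparr>) \<phi> (pt x) = {pt (\<alpha> ^ i * x + j) |i j. el i j \<in> H}"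
proof (intro equalityI subsetI)
  fix y assume "y \<in> orbit (G\<lparr>carrier := H\<rparr>) \<phi> (pt x)"
  then obtain h where h: "h \<in> H" "y = \<phi> h (pt x)" by (auto simp: orbit_def)
  then have "inv h \<in> carrier G" "h \<in> carrier G" "inv h \<in> H"
    using assms by (auto simp: subgroup.mem_carrier subgroup.m_inv_closed)
  moreover from this obtain i j where "inv h = el i j" using carrier_el by blast
  ultimately have "h = inv (el i j)" "el i j \<in> H" by (metis inv_inv, simp)
  then show "y \<in> {pt (\<alpha> ^ i * x + j) |i j. el i j \<in> H}"
    using h(2) by (auto simp: action_pt)
next
  fix y assume "y \<in> {pt (\<alpha> ^ i * x + j) |i j. el i j \<in> H}"
  then obtain i j where "el i j \<in> H" "y = \<phi> (inv (el i j)) (pt x)"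
    by (auto simp: action_pt)
  then show "y \<in> orbit (G\<lparr>carrier := H\<rparr>) \<phi> (pt x)"
    using assms by (auto simp: orbit_def subgroup.m_inv_closed)
qed

text \<open>The exponents \<open>j\<close> on the right are the labels of the orbit of
  \<open>pt 0\<close>, so the condition says that this orbit is all of \<open>E\<close>.\<close>

lemma transitive_iff:
  assumes "subgroup H G"
  shows "transitive_action (G\<lparr>carrier := H\<rparr>) E \<phi> \<longleftrightarrow>
    (\<forall>y. \<exists>i j. el i j \<in> H \<and> [j = y] (mod int n))"
proof
  assume trans: "transitive_action (G\<lparr>carrier := H\<rparr>) E \<phi>"
  have "pt y \<in> orbit (G\<lparr>carrier := H\<rparr>) \<phi> (pt 0)" for y
    using transitive_action.unique_orbit[OF trans, of "pt 0" "pt y"] unfolding orbit_def by force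
  then show "\<forall>y. \<exists>i j. el i j \<in> H \<and> [j = y] (mod int n)"
    unfolding orbit_pt[OF assms] by (simp add: pt_eq_iff) (metis cong_sym)
next
  assume reach: "\<forall>y. \<exists>i j. el i j \<in> H \<and> [j = y] (mod int n)"
  interpret H: group_action "G\<lparr>carrier := H\<rparr>" E \<phi> by (rule induced_action[OF assms])
  have "pt y \<in> orbit (G\<lparr>carrier := H\<rparr>) \<phi> (pt 0)" for y
    using reach unfolding orbit_pt[OF assms] by (simp add: pt_eq_iff) (metis cong_sym)
  then have "y \<in> orbit (G\<lparr>carrier := H\<rparr>) \<phi> x" if xy: "x \<in> E" "y \<in> E" for x y
  proof -
    obtain k l where "x = pt k" "y = pt l" using xy unfolding E_eq by blast
    then show ?thesis
      using \<open>\<And>y. pt y \<in> _\<close> H.orbit_sym[of "pt 0" x] H.orbit_trans[of x "pt 0" y] by simp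
  qed
  then show "transitive_action (G\<lparr>carrier := H\<rparr>) E \<phi>"
    by unfold_locales (auto simp: orbit_def)
qed

section \<open>Membership in \<open>M(r)\<close> and \<open>P\<close> in coordinates\<close>

lemma mem_M_sub:
  assumes "r dvd n"
  shows "el i j \<in> M_sub G a w r \<longleftrightarrow> int r dvd j"
proof
  let ?S = "{g. \<exists>i j. g = el i j \<and> int r dvd j}"
  have "a = el 1 0" "w [^] r = el 0 (int r)" by (simp_all add: el_def int_pow_int)
  then have "M_sub G a w r \<subseteq> ?S"
    unfolding M_sub_def by (intro generate_subset_el_set) auto
  moreover assume "el i j \<in> M_sub G a w r"
  ultimately obtain k l where "el i j = el k l" "int r dvd l" by blast
  \<comment> \<open>Two coordinates of one element have \<open>w\<close>-exponents congruent modulo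
    \<open>n\<close>, hence modulo its divisor \<open>r\<close>.\<close>
  then show "int r dvd j"
    using el_eqD(1) assms by (metis cong_dvd_iff cong_dvd_modulus int_dvd_int_iff)
next
  assume "int r dvd j"
  then obtain t where j: "j = int r * t" ..
  have sub: "subgroup (M_sub G a w r) G"
    unfolding M_sub_def by (rule generate_is_subgroup) auto
  have "a \<in> M_sub G a w r" "w [^] int r \<in> M_sub G a w r"
    unfolding M_sub_def int_pow_int by (auto intro: generate.incl)
  then have "a [^] int i \<in> M_sub G a w r" "(w [^] int r) [^] t \<in> M_sub G a w r"
    by (auto intro: subgroup_int_pow_closed[OF sub])
  then have "a [^] i \<in> M_sub G a w r" "w [^] j \<in> M_sub G a w r"
    using int_pow_pow[OF w, of "int r" t] by (simp_all add: j int_pow_int)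
  then show "el i j \<in> M_sub G a w r"
    unfolding el_def by (rule subgroup.m_closed[OF sub])
qed

lemma subgroup_M_sub: "subgroup (M_sub G a w r) G"
  unfolding M_sub_def by (rule generate_is_subgroup) auto

lemma subgroup_P_sub: "subgroup (P_sub G a w) G"
  unfolding P_sub_def by (rule generate_is_subgroup) auto

lemma pow_minus_one_cong:
  assumes "[\<alpha> = -1] (mod 4)"
  shows "[\<alpha> ^ i = (if odd i then -1 else 1)] (mod 4)"
  using cong_pow[OF assms, of i] by (cases "odd i") simp_all

lemma four_dvd_int_n: "negative_aut n \<alpha> \<Longrightarrow> 4 dvd int n"
  using of_nat_dvd_iff[of 4 n, where 'a = int] by (simp add: negative_aut_def)

text \<open>The congruence says that \<open>el i j\<close> acts on residues modulo 4 as
  \<open>x \<mapsto> x\<close> for even \<open>i\<close> and as \<open>x \<mapsto> 1 - x\<close> for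
  odd \<open>i\<close>. These two maps form a group, whence closure under products.\<close>

lemma mem_P_sub:
  assumes "negative_aut n \<alpha>"
  shows "el i j \<in> P_sub G a w \<longleftrightarrow> [j = of_bool (odd i)] (mod 4)"
proof -
  note n4 = four_dvd_int_n[OF assms]
  have \<alpha>4: "[\<alpha> ^ i = (if odd i then -1 else 1)] (mod 4)" for i
    using assms by (intro pow_minus_one_cong) (simp add: negative_aut_def)
  let ?Q = "\<lambda>i j. [j = of_bool (odd i)] (mod (4::int))"
  let ?S = "{g. \<exists>i j. g = el i j \<and> ?Q i j}"
  have mult: "?Q (i + k) (\<alpha> ^ k * j + l)" if "?Q i j" "?Q k l" for i j k l
  proof -
    have "[\<alpha> ^ k * j + l = (if odd k then -1 else 1) * of_bool (odd i) + of_bool (odd k)] (mod 4)"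
      by (intro cong_add cong_mult \<alpha>4 that)
    also have "(if odd k then -1 else 1) * of_bool (odd i) + of_bool (odd k) =
        (of_bool (odd (i + k)) :: int)"
      by (cases "odd i"; cases "odd k") simp_all
    finally show ?thesis .
  qed
  \<comment> \<open>The parity of \<open>i\<close> depends only on the element: equal powers of
    \<open>a\<close> give equal powers of \<open>\<alpha>\<close> modulo 4, and these are -1 or 1
    according to parity.\<close>
  have well_defined: "?Q i j" if "el i j = el k l" "?Q k l" for i j k l
  proof -
    have j: "[j = l] (mod 4)" using el_eqD(1)[OF that(1)] n4 by (rule cong_dvd_modulus)
    have "[\<alpha> ^ i = \<alpha> ^ k] (mod 4)"
      using \<alpha>_pow_cong[OF el_eqD(2)[OF that(1)]] n4 by (rule cong_dvd_modulus)
    from cong_trans[OF cong_trans[OF cong_sym[OF \<alpha>4] this] \<alpha>4]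
    have "odd i \<longleftrightarrow> odd k" by (cases "odd i"; cases "odd k") (simp_all add: cong_def)
    then show ?thesis using cong_trans[OF j that(2)] by simp
  qed
  have "a \<otimes> w = el 1 1" "w [^] (4::nat) = el 0 4"
    by (simp_all add: el_def) (metis int_pow_int of_nat_numeral)
  moreover have "?Q 0 4" "?Q 1 1" by (simp_all add: cong_def)
  moreover have "?Q 0 0" by simp
  ultimately have S: "P_sub G a w \<subseteq> ?S"
    unfolding P_sub_def using mult by (intro generate_subset_el_set)
  have gens: "el 1 1 \<in> P_sub G a w" "el 0 4 \<in> P_sub G a w"
    unfolding P_sub_def \<open>a \<otimes> w = el 1 1\<close>[symmetric] \<open>w [^] (4::nat) = el 0 4\<close>[symmetric]
    by (auto intro: generate.incl)
  have w4: "el 0 j \<in> P_sub G a w" if "[j = 0] (mod 4)" for j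
  proof -
    from that obtain t where "j = 4 * t" by (auto simp: cong_0_iff)
    then show ?thesis
      using subgroup_int_pow_closed[OF subgroup_P_sub gens(2), of t]
      by (simp add: el_w int_pow_pow)
  qed
  \<comment> \<open>Once \<open>P\<close> contains some \<open>el i l\<close>, membership of
    \<open>el i j\<close> reduces to \<open>w [^] (j - l)\<close> being a power of the generator
    \<open>w [^] 4\<close>.\<close>
  have power: "\<exists>l. el i l \<in> P_sub G a w" for i
  proof (induction i)
    case 0 then show ?case using w4[of 0] by auto
  next
    case (Suc i)
    then obtain l where "el i l \<in> P_sub G a w" ..
    then have "el i l \<otimes> el 1 1 \<in> P_sub G a w"
      using gens(1) subgroup_P_sub by (simp add: subgroup.m_closed)
    then show ?case by (auto simp: el_mult)
  qed
  show ?thesis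
  proof
    assume "el i j \<in> P_sub G a w"
    with S obtain k l where "el i j = el k l" "?Q k l" by blast
    then show "?Q i j" by (rule well_defined)
  next
    assume Q: "?Q i j"
    obtain l where l: "el i l \<in> P_sub G a w" using power by blast
    with S well_defined have "?Q i l" by blast
    with Q have "[j - l = 0] (mod 4)"
      by (metis cong_trans cong_sym cong_diff_iff_cong_0)
    from subgroup.m_closed[OF subgroup_P_sub l w4[OF this]]
    show "el i j \<in> P_sub G a w" by (simp add: el_mult)
  qed
qed

subsection \<open>Intransitive subgroups\<close>

lemma el_diff_mem:
  assumes "subgroup H G" "el i j \<in> H" "el i m \<in> H"
  shows "el 0 (j - m) \<in> H"
proof -
  have "inv (el i m) \<otimes> el i j \<in> H"
    using assms by (simp add: subgroup.m_closed subgroup.m_inv_closed)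
  also have "inv (el i m) \<otimes> el i j = el 0 (j - m)"
  proof -
    have "el i j = el i m \<otimes> el 0 (j - m)" by (simp add: el_mult)
    then show ?thesis by (simp flip: m_assoc)
  qed
  finally show ?thesis .
qed

text \<open>Two subgroups of the integers describe \<open>H\<close>: the exponents of
  \<open>w\<close> in the intersection of \<open>H\<close> with \<open>W\<close>, generated by
  \<open>d\<close>, and the exponents of \<open>a\<close> occurring in \<open>H\<close> modulo
  \<open>W\<close>, generated by \<open>k\<close>. Some \<open>el k c\<close> lies in
  \<open>H\<close>, and the powers of this element represent all cosets of the intersection in
  \<open>H\<close>.\<close>

lemma subgroup_structure:
  assumes H: "subgroup H G"
  obtains k d :: nat and c :: int where "0 < d" "d dvd n"
    "\<And>i j. el i j \<in> H \<longleftrightarrow> (\<exists>q. i = k * q \<and> [j = c * (\<Sum>s<q. (\<alpha> ^ k) ^ s)] (mod int d))"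
proof -
  define D where "D = {j. el 0 j \<in> H}"
  have one: "el 0 0 \<in> H" using subgroup.one_closed[OF H] by (simp add: el_def)
  \<comment> \<open>This supplies the positive element needed for \<open>d\<close> and later yields
    \<open>d dvd n\<close>; \<open>order G\<close> plays the same part for \<open>k\<close>.\<close>
  have n_mem: "int n \<in> D"
    using one el_cong[of "int n" 0 0] by (simp add: D_def cong_0_iff)
  have "j - m \<in> D" if "j \<in> D" "m \<in> D" for j m
    using el_diff_mem[OF H] that by (simp add: D_def)
  then obtain d where d: "0 < d" "\<And>j. j \<in> D \<longleftrightarrow> int d dvd j"
    using int_subgroup_multiples[OF n_mem] n_pos by auto
  \<comment> \<open>the exponents occurring in the image of \<open>H\<close> in \<open>G / W\<close>\<close>
  define I where "I = {i::int. \<exists>(k::nat) l. a [^] k = a [^] i \<and> el k l \<in> H}"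
  have "a [^] (0::nat) = a [^] int (order G)"
    using pow_order_eq_1[OF a] by (simp add: int_pow_int)
  with one have order_mem: "int (order G) \<in> I" unfolding I_def by blast
  have order_pos: "0 < int (order G)"
    using finite_carrier by (simp add: order_gt_0_iff_finite)
  have "i - i' \<in> I" if ii: "i \<in> I" "i' \<in> I" for i i'
  proof -
    obtain k k' :: nat and l l' where kl: "a [^] k = a [^] i" "el k l \<in> H"
      "a [^] k' = a [^] i'" "el k' l' \<in> H"
      using ii unfolding I_def by blast
    have inv_mem: "inv (el k' l') \<in> H" using kl H by (simp add: subgroup.m_inv_closed)
    \<comment> \<open>The inverse is rewritten with a natural exponent \<open>m\<close> of
      \<open>a\<close>, as \<open>el\<close> admits no negative one.\<close>
    obtain m t where mt: "inv (el k' l') = el m t" using carrier_el by (meson el_closed inv_closed)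
    then have "el k' l' \<otimes> el m t = el 0 0" by (metis el_closed el_w int_pow_0 r_inv)
    then have "a [^] (k' + m) = a [^] (0::nat)" unfolding el_mult using el_eqD(2) by fastforce
    then have "a [^] k' \<otimes> a [^] m = \<one>" by (simp add: nat_pow_mult)
    then have "a [^] m = inv (a [^] i')"
      using kl(3) by (metis a int_pow_closed inv_char inv_equality inv_inv nat_pow_closed r_inv)
    then have "a [^] (k + m) = a [^] (i - i')"
      by (simp add: int_pow_diff kl(1) flip: nat_pow_mult)
    moreover have "el k l \<otimes> inv (el k' l') \<in> H"
      using kl(2) inv_mem H by (simp add: subgroup.m_closed)
    ultimately show ?thesis unfolding I_def mt el_mult by blast
  qed
  then obtain k where k: "0 < k" "\<And>i. i \<in> I \<longleftrightarrow> int k dvd i"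
    using int_subgroup_multiples[OF order_mem order_pos] by metis
  have "int k \<in> I" by (simp add: k(2))
  then obtain k' :: nat and c where "a [^] k' = a [^] int k" "el k' c \<in> H"
    unfolding I_def by blast
  \<comment> \<open>\<open>k'\<close> and \<open>k\<close> may differ as numbers, but they give the
    same power of \<open>a\<close> and hence the same element.\<close>
  then have c: "el k c \<in> H" by (simp add: el_def int_pow_int)
  \<comment> \<open>The \<open>w\<close>-exponent of the \<open>q\<close>-th power of
    \<open>el k c\<close>, that is, the \<open>q\<close>-th iterate of 0 under
    \<open>x \<mapsto> \<alpha> ^ k * x + c\<close>.\<close>
  let ?S = "\<lambda>q. c * (\<Sum>s<q. (\<alpha> ^ k) ^ s)"
  have power: "el (k * q) (?S q) \<in> H" for q
  proof (induction q)
    case (Suc q)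
    have "el k c \<otimes> el (k * q) (?S q) \<in> H" using c Suc H by (simp add: subgroup.m_closed)
    then show ?case by (simp add: el_mult distrib_left power_mult algebra_simps)
  qed (simp add: one)
  have "el i j \<in> H \<longleftrightarrow> (\<exists>q. i = k * q \<and> [j = ?S q] (mod int d))" for i j
  proof
    assume ij: "el i j \<in> H"
    then have "int i \<in> I" unfolding I_def by (auto simp: int_pow_int)
    then obtain q where q: "i = k * q" using k(2) by (auto elim!: dvdE)
    have "j - ?S q \<in> D"
      using el_diff_mem[OF H] ij power[of q] unfolding D_def q by blast
    with q show "\<exists>q. i = k * q \<and> [j = ?S q] (mod int d)"
      unfolding d(2) cong_iff_dvd_diff by blast
  next
    assume "\<exists>q. i = k * q \<and> [j = ?S q] (mod int d)"
    then obtain q where q: "i = k * q" "j - ?S q \<in> D"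
      unfolding d(2) cong_iff_dvd_diff by blast
    then have "el (k * q) (?S q) \<otimes> el 0 (j - ?S q) \<in> H"
      using power[of q] H by (simp add: D_def subgroup.m_closed)
    then show "el i j \<in> H" by (simp add: el_mult q(1))
  qed
  moreover have "d dvd n" using n_mem unfolding d(2) by simp
  ultimately show ?thesis using that d(1) by blast
qed

text \<open>The orbit of \<open>p\<close> carries only labels divisible by \<open>r\<close> and so
  misses the label 1.\<close>

lemma intransitive_M_sub:
  assumes "Factorial_Ring.prime r" "r dvd n"
  shows "intransitive_subgroup G E \<phi> (M_sub G a w r)"
proof -
  have "\<not> (\<exists>i j. el i j \<in> M_sub G a w r \<and> [j = 1] (mod int n))"
  proof
    assume "\<exists>i j. el i j \<in> M_sub G a w r \<and> [j = 1] (mod int n)"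
    then obtain j where j: "int r dvd j" "[j = 1] (mod int n)"
      using mem_M_sub[OF assms(2)] by blast
    then have "[j = 1] (mod int r)"
      using assms(2) by (metis cong_dvd_modulus int_dvd_int_iff)
    with j(1) have "int r dvd 1" using cong_dvd_iff by blast
    with assms(1) show False by simp
  qed
  then show ?thesis
    unfolding intransitive_subgroup_def using subgroup_M_sub transitive_iff by blast
qed

text \<open>The orbit of \<open>p\<close> carries only labels that are 0 or 1 modulo 4 and so misses
  the label 2.\<close>

lemma intransitive_P_sub:
  assumes "negative_aut n \<alpha>"
  shows "intransitive_subgroup G E \<phi> (P_sub G a w)"
proof -
  have "\<not> (\<exists>i j. el i j \<in> P_sub G a w \<and> [j = 2] (mod int n))"
  proof
    assume "\<exists>i j. el i j \<in> P_sub G a w \<and> [j = 2] (mod int n)"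
    then obtain i :: nat and j where j: "[j = of_bool (odd i)] (mod 4)" "[j = 2] (mod int n)"
      using mem_P_sub[OF assms] by blast
    from j(2) four_dvd_int_n[OF assms] have "[j = 2] (mod 4)" by (rule cong_dvd_modulus)
    with j(1) show False by (cases "odd i") (simp_all add: cong_def)
  qed
  then show ?thesis
    unfolding intransitive_subgroup_def using subgroup_P_sub transitive_iff by blast
qed

text \<open>The exponent \<open>x\<close> is the point that conjugation moves to 0. A fixed point
  modulo a prime leads to \<open>M(r)\<close>; without one, the full-period criterion can fail only
  at 4, which forces the case of \<open>P\<close>.\<close>

lemma intransitive_contained:
  assumes "intransitive_subgroup G E \<phi> H"
  shows "\<exists>x. (\<exists>r. Factorial_Ring.prime r \<and> r dvd n \<and>
        (\<forall>h\<in>H. w [^] (x::int) \<otimes> h \<otimes> inv (w [^] x) \<in> M_sub G a w r)) \<or>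
      negative_aut n \<alpha> \<and> (\<forall>h\<in>H. w [^] x \<otimes> h \<otimes> inv (w [^] x) \<in> P_sub G a w)"
proof -
  have H: "subgroup H G" and intrans: "\<not> (\<forall>y. \<exists>i j. el i j \<in> H \<and> [j = y] (mod int n))"
    using assms transitive_iff unfolding intransitive_subgroup_def by blast+
  have H_el: "\<exists>i j. h = el i j" if "h \<in> H" for h
    using that carrier_el subgroup.mem_carrier[OF H] by blast
  obtain k d c where d: "0 < d" "d dvd n"
    and mem_H: "\<And>i j. el i j \<in> H \<longleftrightarrow>
      (\<exists>q. i = k * q \<and> [j = c * (\<Sum>s<q. (\<alpha> ^ k) ^ s)] (mod int d))"
    using subgroup_structure[OF H] by metis
  let ?b = "\<alpha> ^ k"
  let ?S = "\<lambda>q. \<Sum>s<q. ?b ^ s"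
  show ?thesis
  proof (cases "\<exists>r x. Factorial_Ring.prime r \<and> r dvd d \<and> [?b * x + c = x] (mod int r)")
    case True
    then obtain r x where r: "Factorial_Ring.prime r" "r dvd d"
      and x: "[?b * x + c = x] (mod int r)" by blast
    have rn: "r dvd n" using r(2) d(2) by (rule dvd_trans)
    \<comment> \<open>A point fixed by the affine map of the generator \<open>el k c\<close> is
      fixed by all its iterates, hence modulo \<open>r\<close> by all of \<open>H\<close>.\<close>
    have fix_pow: "[?b ^ q * x + c * ?S q = x] (mod int r)" for q
    proof (induction q)
      case (Suc q)
      have "?b ^ Suc q * x + c * ?S (Suc q) = ?b ^ q * (?b * x + c) + c * ?S q"
        by (simp add: algebra_simps)
      also have "[\<dots> = ?b ^ q * x + c * ?S q] (mod int r)"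
        using x by (intro cong_add cong_mult cong_refl)
      finally show ?case using Suc by (rule cong_trans)
    qed simp
    have "w [^] x \<otimes> h \<otimes> inv (w [^] x) \<in> M_sub G a w r" if h: "h \<in> H" for h
    proof -
      obtain i j where ij: "h = el i j" using H_el h by blast
      with h mem_H obtain q where q: "i = k * q" "[j = c * ?S q] (mod int d)" by blast
      have "[j = c * ?S q] (mod int r)"
        using q(2) r(2) by (metis cong_dvd_modulus int_dvd_int_iff)
      then have "[\<alpha> ^ i * x + j = ?b ^ q * x + c * ?S q] (mod int r)"
        unfolding q(1) power_mult by (rule cong_add[OF cong_refl])
      then have "[\<alpha> ^ i * x + j = x] (mod int r)" using fix_pow by (rule cong_trans)
      then show ?thesis
        unfolding ij conj_el mem_M_sub[OF rn] cong_iff_dvd_diff by simp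
    qed
    with r(1) rn show ?thesis by blast
  next
    case False
    have b1: "[?b = 1] (mod int r)" if "Factorial_Ring.prime r" "r dvd d" for r
      using affine_fixed_point_mod_prime[of r ?b c] that False by blast
    have "\<not> int r dvd c" if "Factorial_Ring.prime r" "r dvd d" for r
    proof
      assume "int r dvd c"
      then have "[?b * 0 + c = 0] (mod int r)" by (simp add: cong_0_iff)
      with that False show False by blast
    qed
    \<comment> \<open>The point 0 is not fixed modulo any prime divisor of \<open>d\<close>, so none
      of these primes divides \<open>c\<close>.\<close>
    then have c: "coprime c (int d)" using common_prime_factor_int by blast
    have four: "4 dvd d" "\<not> [?b = 1] (mod 4)"
    proof -
      \<comment> \<open>Under this implication the iterates of 0 would meet every residue modulo
        \<open>d\<close>, and \<open>H\<close> would be transitive.\<close>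
      have "\<not> (4 dvd d \<longrightarrow> [?b = 1] (mod 4))"
      proof
        assume "4 dvd d \<longrightarrow> [?b = 1] (mod 4)"
        have "\<exists>i j. el i j \<in> H \<and> [j = y] (mod int n)" for y
        proof -
          obtain q where "[y = c * ?S q] (mod int d)"
            using affine_orbit_exhaustive[OF d(1) c] b1 \<open>4 dvd d \<longrightarrow> _\<close> by metis
          then have "el (k * q) y \<in> H" unfolding mem_H by blast
          then show ?thesis using cong_refl by blast
        qed
        with intrans show False by blast
      qed
      then show "4 dvd d" "\<not> [?b = 1] (mod 4)" by simp_all
    qed
    have d4: "4 dvd int d" using four(1) of_nat_dvd_iff[of 4 d, where 'a = int] by simp
    have "2 dvd d" using four(1) by (rule dvd_trans[rotated]) simp
    then have "odd ?b" using b1[of 2] cong_dvd_iff[of ?b 1 2] by simp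
    moreover have "k \<noteq> 0" using four(2) by (metis cong_refl power_0)
    ultimately have \<alpha>odd: "odd \<alpha>" by simp
    have "odd c" using c d4 by (metis coprime_common_divisor dvd_trans even_numeral odd_one dvd_refl)
    then obtain x where x: "c = 2 * x + 1" by (rule oddE)
    have "\<not> [\<alpha> = 1] (mod 4)" using four(2) cong_pow[of \<alpha> 1 4 k] by auto
    then have \<alpha>4: "[\<alpha> = -1] (mod 4)" using odd_cong_4[OF \<alpha>odd] by blast
    have neg: "negative_aut n \<alpha>"
      unfolding negative_aut_def using \<alpha>4 four(1) d(2) dvd_trans by blast
    note \<alpha>_pow = pow_minus_one_cong[OF \<alpha>4]
    \<comment> \<open>An even \<open>k\<close> would make \<open>?b\<close> congruent to 1 modulo
      4.\<close>
    have "odd k" using \<alpha>_pow[of k] four(2) by (auto split: if_splits)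
    then have b4: "[?b ^ q = (if odd q then -1 else 1)] (mod 4)" for q
      using \<alpha>_pow[of "k * q"] by (simp flip: power_mult)
    \<comment> \<open>The terms alternate between 1 and -1 modulo 4, so the partial sums alternate
      between 0 and 1.\<close>
    have S4: "[?S q = of_bool (odd q)] (mod 4)" for q
    proof (induction q)
      case (Suc q)
      have "[?S (Suc q) = of_bool (odd q) + (if odd q then -1 else 1)] (mod 4)"
        unfolding sum.lessThan_Suc by (intro cong_add Suc b4)
      then show ?case by (cases "odd q") simp_all
    qed simp
    \<comment> \<open>\<open>x = (c - 1) / 2\<close> solves \<open>c - 2 x = 1\<close>, the condition for conjugating \<open>a\<^sup>k w\<^sup>c\<close> into \<open>P\<close>\<close>
    have "w [^] x \<otimes> h \<otimes> inv (w [^] x) \<in> P_sub G a w" if h: "h \<in> H" for h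
    proof -
      obtain i j where ij: "h = el i j" using H_el h by blast
      with h mem_H obtain q where q: "i = k * q" "[j = c * ?S q] (mod int d)" by blast
      have "[j = c * ?S q] (mod 4)" using q(2) d4 by (rule cong_dvd_modulus)
      also have "[c * ?S q = c * of_bool (odd q)] (mod 4)"
        by (intro cong_mult cong_refl S4)
      finally have "[\<alpha> ^ i * x + j - x = (if odd q then -1 else 1) * x + c * of_bool (odd q) - x] (mod 4)"
        unfolding q(1) power_mult by (intro cong_diff cong_add cong_mult cong_refl b4)
      also have "(if odd q then -1 else 1) * x + c * of_bool (odd q) - x = of_bool (odd i)"
        using \<open>odd k\<close> unfolding q(1) x by simp
      finally show ?thesis unfolding ij conj_el mem_P_sub[OF neg] .
    qed
    with neg show ?thesis by blast
  qed
qed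

section \<open>No conjugate of one member of the family lies in another\<close>

lemma conj_generator_mem:
  assumes g: "g \<in> carrier G"
  shows "\<exists>i. inv g \<otimes> w [^] m \<otimes> g = el 0 (\<alpha> ^ i * m)"
proof -
  obtain i j where g_el: "g = el i j" using carrier_el[OF g] by blast
  \<comment> \<open>The \<open>w\<close>-part of \<open>g\<close> commutes with
    \<open>w [^] m\<close>, so only the factor \<open>\<alpha> ^ i\<close> remains, a unit modulo
    \<open>n\<close>.\<close>
  have "el 0 m \<otimes> g = g \<otimes> el 0 (\<alpha> ^ i * m)" by (simp add: g_el el_mult algebra_simps)
  then have "inv g \<otimes> w [^] m \<otimes> g = el 0 (\<alpha> ^ i * m)"
    using g by (simp add: el_w m_assoc) (simp flip: m_assoc)
  then show ?thesis ..
qed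

text \<open>A conjugate of \<open>w [^] r\<close> has exponent a unit times \<open>r\<close>, so
  \<open>s\<close> divides \<open>r\<close>.\<close>

lemma conj_M_sub_subset_M_sub:
  assumes r: "Factorial_Ring.prime r" "r dvd n" and s: "Factorial_Ring.prime s" "s dvd n"
    and g: "g \<in> carrier G" and sub: "\<And>h. h \<in> M_sub G a w r \<Longrightarrow> inv g \<otimes> h \<otimes> g \<in> M_sub G a w s"
  shows "r = s"
proof -
  obtain i where i: "inv g \<otimes> w [^] int r \<otimes> g = el 0 (\<alpha> ^ i * int r)"
    using conj_generator_mem[OF g] by blast
  have "el 0 (int r) \<in> M_sub G a w r" by (simp add: mem_M_sub[OF r(2)])
  then have "el 0 (\<alpha> ^ i * int r) \<in> M_sub G a w s" using sub i by (metis el_w)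
  then have "int s dvd \<alpha> ^ i * int r" by (simp add: mem_M_sub[OF s(2)])
  moreover have "coprime (int s) (\<alpha> ^ i)"
    using coprime_\<alpha> s(2) by (metis coprime_commute coprime_divisors coprime_power_right_iff dvd_refl int_dvd_int_iff)
  ultimately have "s dvd r" by (simp add: coprime_dvd_mult_right_iff)
  with r s show ?thesis by (metis primes_dvd_imp_eq)
qed

text \<open>The conjugate of \<open>w [^] r\<close> would force 4 to divide the prime
  \<open>r\<close>.\<close>

lemma not_conj_M_sub_subset_P_sub:
  assumes r: "Factorial_Ring.prime r" "r dvd n" and neg: "negative_aut n \<alpha>"
    and g: "g \<in> carrier G" and sub: "\<And>h. h \<in> M_sub G a w r \<Longrightarrow> inv g \<otimes> h \<otimes> g \<in> P_sub G a w"
  shows False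
proof -
  obtain i where i: "inv g \<otimes> w [^] int r \<otimes> g = el 0 (\<alpha> ^ i * int r)"
    using conj_generator_mem[OF g] by blast
  have "el 0 (int r) \<in> M_sub G a w r" by (simp add: mem_M_sub[OF r(2)])
  then have "el 0 (\<alpha> ^ i * int r) \<in> P_sub G a w" using sub i by (metis el_w)
  then have "4 dvd \<alpha> ^ i * int r" by (simp add: mem_P_sub[OF neg] cong_0_iff)
  moreover have "coprime 4 (\<alpha> ^ i)"
    using coprime_\<alpha> four_dvd_int_n[OF neg]
    by (metis coprime_commute coprime_divisors coprime_power_right_iff dvd_refl)
  ultimately have "4 dvd int r" by (simp add: coprime_dvd_mult_right_iff)
  then have "4 dvd r" using of_nat_dvd_iff[of 4 r, where 'a = int] by simp
  moreover have "(4::nat) = 2 * 2" by simp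
  ultimately have "2 dvd r" by (metis dvd_mult_left)
  with r(1) have "r = 2" by (metis primes_dvd_imp_eq two_is_prime_nat)
  with \<open>4 dvd r\<close> show False by simp
qed

text \<open>The conjugate of \<open>w [^] 4\<close> forces \<open>s = 2\<close>. Then
  \<open>a \<otimes> w\<close> gives the contradiction, because conjugation preserves the parity of
  the \<open>w\<close>-exponent.\<close>

lemma not_conj_P_sub_subset_M_sub:
  assumes s: "Factorial_Ring.prime s" "s dvd n" and neg: "negative_aut n \<alpha>"
    and g: "g \<in> carrier G" and sub: "\<And>h. h \<in> P_sub G a w \<Longrightarrow> inv g \<otimes> h \<otimes> g \<in> M_sub G a w s"
  shows False
proof -
  obtain i where i: "inv g \<otimes> w [^] (4::int) \<otimes> g = el 0 (\<alpha> ^ i * 4)"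
    using conj_generator_mem[OF g] by blast
  have "el 0 4 \<in> P_sub G a w" by (simp add: mem_P_sub[OF neg] cong_def)
  then have "el 0 (\<alpha> ^ i * 4) \<in> M_sub G a w s" using sub i by (metis el_w)
  then have "int s dvd \<alpha> ^ i * 4" by (simp add: mem_M_sub[OF s(2)])
  moreover have "coprime (int s) (\<alpha> ^ i)"
    using coprime_\<alpha> s(2) by (metis coprime_commute coprime_divisors coprime_power_right_iff dvd_refl int_dvd_int_iff)
  ultimately have "int s dvd int (2 * 2)" by (simp add: coprime_dvd_mult_right_iff)
  then have "s dvd 2 * 2" by (simp only: int_dvd_int_iff)
  then have s2: "s = 2"
    using s(1) by (metis prime_dvd_mult_iff primes_dvd_imp_eq two_is_prime_nat)
  have \<alpha>odd: "odd \<alpha>"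
    using neg unfolding negative_aut_def cong_def by presburger
  have "el 1 1 \<in> P_sub G a w" by (simp add: mem_P_sub[OF neg])
  then have "inv g \<otimes> el 1 1 \<otimes> g \<in> M_sub G a w s" by (rule sub)
  moreover obtain k l where kl: "inv g \<otimes> el 1 1 \<otimes> g = el k l"
    using carrier_el g by (metis el_closed inv_closed m_closed)
  ultimately have "even l" using mem_M_sub[OF s(2)] s2 by simp
  obtain u v where uv: "g = el u v" using carrier_el[OF g] by blast
  \<comment> \<open>Comparing the \<open>w\<close>-exponents of both sides modulo 2, where every
    power of \<open>\<alpha>\<close> is 1, gives \<open>1 + v\<close> against \<open>v + l\<close>
    and contradicts \<open>l\<close> even.\<close>
  have "el 1 1 \<otimes> g = g \<otimes> el k l"
    using g by (simp flip: kl m_assoc)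
  then have "[\<alpha> ^ u + v = \<alpha> ^ k * v + l] (mod int n)"
    unfolding uv el_mult using el_eqD(1) by fastforce
  then have "[\<alpha> ^ u + v = \<alpha> ^ k * v + l] (mod 2)"
    using s(2) unfolding s2 by (metis cong_dvd_modulus int_dvd_int_iff of_nat_numeral)
  then have "even (\<alpha> ^ u + v) \<longleftrightarrow> even (\<alpha> ^ k * v + l)"
    by (rule cong_dvd_iff)
  with \<alpha>odd \<open>even l\<close> show False by simp
qed

end

section \<open>Conjugates of intransitive subgroups\<close>

lemma (in group) conjugate_set_eq:
  assumes "H \<subseteq> carrier G" "g \<in> carrier G"
  shows "inv g <# H #> g = (\<lambda>h. inv g \<otimes> h \<otimes> g) ` H"
  using assms unfolding l_coset_def r_coset_def by (auto simp: m_assoc)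

lemma (in group) conjugate_set_conjugate:
  assumes "H \<subseteq> carrier G" "g \<in> carrier G" "h \<in> carrier G"
  shows "inv h <# (inv g <# H #> g) #> h = inv (g \<otimes> h) <# H #> (g \<otimes> h)"
proof -
  have "inv g <# H #> g \<subseteq> carrier G"
    using assms by (auto simp: conjugate_set_eq)
  moreover have "(\<lambda>x. inv h \<otimes> (inv g \<otimes> x \<otimes> g) \<otimes> h) ` H = (\<lambda>x. inv (g \<otimes> h) \<otimes> x \<otimes> (g \<otimes> h)) ` H"
    using assms by (intro image_cong) (auto simp: m_assoc inv_mult_group)
  ultimately show ?thesis
    using assms by (simp add: conjugate_set_eq image_image)
qed

lemma (in group) card_conjugate_set:
  assumes "H \<subseteq> carrier G" "g \<in> carrier G"
  shows "card (inv g <# H #> g) = card H"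
proof -
  have "inj_on (\<lambda>h. inv g \<otimes> h \<otimes> g) H"
    using assms by (auto intro!: inj_onI simp: subset_iff)
  then show ?thesis unfolding conjugate_set_eq[OF assms] by (rule card_image)
qed

lemma (in group) subgroup_conjugate_set:
  assumes "subgroup H G" "g \<in> carrier G"
  shows "subgroup (inv g <# H #> g) G"
proof -
  have H: "H \<subseteq> carrier G" using assms(1) by (rule subgroup.subset)
  have "g \<otimes> (inv g \<otimes> x) = x" if "x \<in> carrier G" for x
    using that assms(2) by (simp flip: m_assoc)
  then have "(\<lambda>h. inv g \<otimes> h \<otimes> g) \<in> hom G G"
    using assms(2) by (auto simp: hom_def m_assoc)
  then interpret c: group_hom G G "\<lambda>h. inv g \<otimes> h \<otimes> g"
    by unfold_locales
  show ?thesis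
    unfolding conjugate_set_eq[OF H assms(2)] by (rule c.subgroup_img_is_subgroup[OF assms(1)])
qed

context group_action
begin

text \<open>The map \<open>\<phi> (inv g)\<close> carries the orbits of \<open>H\<close> to those of
  its conjugate.\<close>

lemma intransitive_subgroup_conjugate:
  assumes H: "intransitive_subgroup G E \<phi> H" and g: "g \<in> carrier G"
  shows "intransitive_subgroup G E \<phi> (inv g <# H #> g)"
proof -
  interpret group G using group_hom by (rule group_hom.axioms(1))
  have sub: "subgroup H G" using H by (simp add: intransitive_subgroup_def)
  then have Hc: "H \<subseteq> carrier G" by (rule subgroup.subset)
  have "\<not> transitive_action (G\<lparr>carrier := inv g <# H #> g\<rparr>) E \<phi>"
  proof
    assume trans: "transitive_action (G\<lparr>carrier := inv g <# H #> g\<rparr>) E \<phi>"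
    interpret H: group_action "G\<lparr>carrier := H\<rparr>" E \<phi> by (rule induced_action[OF sub])
    have "\<exists>h\<in>H. \<phi> h x = y" if xy: "x \<in> E" "y \<in> E" for x y
    proof -
      have E: "\<phi> (inv g) x \<in> E" "\<phi> (inv g) y \<in> E"
        using g xy by (simp_all add: element_image[OF _ _ refl])
      then obtain h where h: "h \<in> H" "\<phi> (inv g \<otimes> h \<otimes> g) (\<phi> (inv g) x) = \<phi> (inv g) y"
        using transitive_action.unique_orbit[OF trans E] Hc g by (auto simp: conjugate_set_eq)
      then have hc: "h \<in> carrier G" using Hc by blast
      have "\<phi> (inv g) (\<phi> h x) = \<phi> (inv g \<otimes> h) x"
        using g hc xy by (simp add: composition_rule)
      also have "inv g \<otimes> h = (inv g \<otimes> h \<otimes> g) \<otimes> inv g"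
        using g hc by (simp add: m_assoc)
      also have "\<phi> \<dots> x = \<phi> (inv g \<otimes> h \<otimes> g) (\<phi> (inv g) x)"
        using g hc xy by (intro composition_rule) auto
      also have "\<dots> = \<phi> (inv g) y" by (rule h(2))
      finally have "\<phi> h x = y"
        using inj_onD[OF inj_prop[OF inv_closed[OF g]], of "\<phi> h x" y]
          element_image[OF hc xy(1) refl] xy(2) by blast
      with h(1) show ?thesis ..
    qed
    then have "transitive_action (G\<lparr>carrier := H\<rparr>) E \<phi>"
      by unfold_locales auto
    with H show False by (simp add: intransitive_subgroup_def)
  qed
  then show ?thesis
    using subgroup_conjugate_set[OF sub g] by (simp add: intransitive_subgroup_def)
qed

section \<open>A criterion for representatives of the classes of maximal intransitive
  subgroups\<close>

context
  fixes \<F> :: "'a set set"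
  assumes finite_G: "finite (carrier G)"
    and intransitive_family: "\<And>K. K \<in> \<F> \<Longrightarrow> intransitive_subgroup G E \<phi> K"
    and covering_family: "\<And>H. intransitive_subgroup G E \<phi> H \<Longrightarrow>
      \<exists>g\<in>carrier G. \<exists>K\<in>\<F>. inv g <# H #> g \<subseteq> K"
    and separated_family: "\<And>K L g. K \<in> \<F> \<Longrightarrow> L \<in> \<F> \<Longrightarrow> g \<in> carrier G \<Longrightarrow>
      inv g <# K #> g \<subseteq> L \<Longrightarrow> K = L"
begin

interpretation group G using group_hom by (rule group_hom.axioms(1))

private lemma intransitive_subset: "intransitive_subgroup G E \<phi> H \<Longrightarrow> H \<subseteq> carrier G"
  unfolding intransitive_subgroup_def by (simp add: subgroup.subset)

text \<open>If \<open>H\<close> contains \<open>K\<close>, a conjugate of \<open>H\<close> lies in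
  some member \<open>L\<close>, and so does a conjugate of \<open>K\<close>. Separation gives
  \<open>K = L\<close>, and comparing cardinalities gives \<open>H = K\<close>.\<close>

lemma maximal_intransitive_family:
  assumes K: "K \<in> \<F>"
  shows "maximal_intransitive G E \<phi> K"
  unfolding maximal_intransitive_def
proof (intro conjI allI impI intransitive_family[OF K])
  fix H assume H: "intransitive_subgroup G E \<phi> H \<and> K \<subseteq> H"
  then have Hc: "H \<subseteq> carrier G" by (simp add: intransitive_subset)
  obtain g L where g: "g \<in> carrier G" and L: "L \<in> \<F>" "inv g <# H #> g \<subseteq> L"
    using covering_family H by blast
  have "inv g <# K #> g \<subseteq> inv g <# H #> g"
    using H Hc g by (subst (1 2) conjugate_set_eq) auto
  then have "K = L" using separated_family[OF K L(1) g] L(2) by blast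
  moreover have "finite L"
    using intransitive_subset[OF intransitive_family[OF L(1)]] finite_G by (rule finite_subset)
  ultimately have "card H \<le> card K"
    using card_mono[OF _ L(2)] card_conjugate_set[OF Hc g] by simp
  moreover have "finite H" using Hc finite_G by (rule finite_subset)
  ultimately show "H = K" using H card_seteq by blast
qed

text \<open>A conjugate of \<open>H\<close> lies in a member \<open>K\<close>. Conjugating
  \<open>K\<close> back gives an intransitive subgroup above \<open>H\<close>, equal to
  \<open>H\<close> by maximality; uniqueness of \<open>K\<close> is separation.\<close>

lemma maximal_intransitive_conjugate_in_family:
  assumes H: "maximal_intransitive G E \<phi> H"
  shows "\<exists>!K. K \<in> \<F> \<and> conjugate_in G H K"
proof -
  have Hi: "intransitive_subgroup G E \<phi> H" using H by (simp add: maximal_intransitive_def)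
  then have Hc: "H \<subseteq> carrier G" by (rule intransitive_subset)
  obtain g K where g: "g \<in> carrier G" and K: "K \<in> \<F>" "inv g <# H #> g \<subseteq> K"
    using covering_family[OF Hi] by blast
  have Kc: "K \<subseteq> carrier G" by (rule intransitive_subset[OF intransitive_family[OF K(1)]])
  have "intransitive_subgroup G E \<phi> (inv (inv g) <# K #> inv g)"
    using intransitive_subgroup_conjugate[OF intransitive_family[OF K(1)], of "inv g"] g by simp
  moreover have "H \<subseteq> inv (inv g) <# K #> inv g"
  proof
    fix h assume h: "h \<in> H"
    then have "inv g \<otimes> h \<otimes> g \<in> K" using K(2) conjugate_set_eq[OF Hc g] by auto
    moreover have "h = inv (inv g) \<otimes> (inv g \<otimes> h \<otimes> g) \<otimes> inv g"
    proof -
      have hc: "h \<in> carrier G" using h Hc by blast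
      then have "g \<otimes> (inv g \<otimes> h) = h" using g by (simp flip: m_assoc)
      then show ?thesis using hc g by (simp add: m_assoc)
    qed
    ultimately show "h \<in> inv (inv g) <# K #> inv g"
      unfolding conjugate_set_eq[OF Kc inv_closed[OF g]] by (rule image_eqI[rotated])
  qed
  ultimately have "inv (inv g) <# K #> inv g = H"
    using H by (simp add: maximal_intransitive_def)
  then have "card K = card H" using card_conjugate_set[OF Kc inv_closed[OF g]] by simp
  moreover have "finite K" using Kc finite_G by (rule finite_subset)
  ultimately have "K = inv g <# H #> g"
    using card_conjugate_set[OF Hc g] K(2) by (metis card_subset_eq)
  with g have "conjugate_in G H K" unfolding conjugate_in_def by blast
  moreover have "L = K" if L: "L \<in> \<F>" "conjugate_in G H L" for L
  proof -
    obtain h where h: "h \<in> carrier G" "L = inv h <# H #> h"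
      using L(2) unfolding conjugate_in_def by blast
    \<comment> \<open>\<open>K\<close> is conjugated to \<open>H\<close> by \<open>inv g\<close> and
      then to \<open>L\<close> by \<open>h\<close>, so separation applies to the product.\<close>
    have "inv (inv g \<otimes> h) <# K #> (inv g \<otimes> h) = inv h <# (inv (inv g) <# K #> inv g) #> h"
      using conjugate_set_conjugate[OF Kc inv_closed[OF g] h(1)] by simp
    also have "\<dots> = L" by (simp add: \<open>inv (inv g) <# K #> inv g = H\<close> h(2))
    finally show ?thesis using separated_family[OF K(1) L(1), of "inv g \<otimes> h"] g h(1) by simp
  qed
  ultimately show ?thesis using K(1) by blast
qed

end

end

context cyclic_regular
begin

section \<open>The family formed by the \<open>M(r)\<close> and, for negative \<open>a\<close>, by
  \<open>P\<close>\<close>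

definition standard_family :: "'a set set" where
  "standard_family = M_sub G a w ` {r. Factorial_Ring.prime r \<and> r dvd n} \<union>
    (if negative_aut n \<alpha> then {P_sub G a w} else {})"

lemma M_sub_in_family: "Factorial_Ring.prime r \<Longrightarrow> r dvd n \<Longrightarrow> M_sub G a w r \<in> standard_family"
  unfolding standard_family_def by blast

lemma P_sub_in_family: "negative_aut n \<alpha> \<Longrightarrow> P_sub G a w \<in> standard_family"
  unfolding standard_family_def by simp

lemma family_intransitive: "K \<in> standard_family \<Longrightarrow> intransitive_subgroup G E \<phi> K"
  unfolding standard_family_def by (auto simp: intransitive_M_sub intransitive_P_sub split: if_splits)

lemma family_covering:
  assumes H: "intransitive_subgroup G E \<phi> H"
  shows "\<exists>g\<in>carrier G. \<exists>K\<in> standard_family. inv g <# H #> g \<subseteq> K"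
proof -
  obtain x K where K: "K \<in> standard_family" "\<forall>h\<in>H. w [^] (x::int) \<otimes> h \<otimes> inv (w [^] x) \<in> K"
    using intransitive_contained[OF H] M_sub_in_family P_sub_in_family by blast
  have Hc: "H \<subseteq> carrier G" using H by (simp add: intransitive_subgroup_def subgroup.subset)
  have "inv (inv (w [^] x)) <# H #> inv (w [^] x) \<subseteq> K"
    using K(2) Hc by (subst conjugate_set_eq) auto
  with K(1) show ?thesis by (meson int_pow_closed inv_closed w)
qed

lemma family_separated:
  assumes "K \<in> standard_family" "L \<in> standard_family" and g: "g \<in> carrier G" and sub: "inv g <# K #> g \<subseteq> L"
  shows "K = L"
proof -
  have Kc: "K \<subseteq> carrier G"
    using family_intransitive[OF assms(1)] by (simp add: intransitive_subgroup_def subgroup.subset)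
  have "inv g \<otimes> h \<otimes> g \<in> L" if "h \<in> K" for h
    using sub that unfolding conjugate_set_eq[OF Kc g] by blast
  then show ?thesis
    using assms(1,2) g conj_M_sub_subset_M_sub not_conj_M_sub_subset_P_sub not_conj_P_sub_subset_M_sub
    unfolding standard_family_def by (auto split: if_splits) metis+
qed

text \<open>Separation with trivial conjugator; it turns uniqueness of a subgroup in the family into
  uniqueness of the prime.\<close>

lemma M_sub_inj:
  assumes "Factorial_Ring.prime r" "r dvd n" "Factorial_Ring.prime s" "s dvd n"
    and "M_sub G a w r = M_sub G a w s"
  shows "r = s"
proof (rule conj_M_sub_subset_M_sub[OF assms(1-4) one_closed])
  fix h assume "h \<in> M_sub G a w r"
  then show "inv \<one> \<otimes> h \<otimes> \<one> \<in> M_sub G a w s"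
    using assms(5) subgroup.mem_carrier[OF subgroup_M_sub] by simp
qed

lemma M_sub_neq_P_sub:
  assumes "Factorial_Ring.prime r" "r dvd n" "negative_aut n \<alpha>"
  shows "M_sub G a w r \<noteq> P_sub G a w"
proof
  assume eq: "M_sub G a w r = P_sub G a w"
  show False
  proof (rule not_conj_M_sub_subset_P_sub[OF assms one_closed])
    fix h assume "h \<in> M_sub G a w r"
    then show "inv \<one> \<otimes> h \<otimes> \<one> \<in> P_sub G a w"
      using eq subgroup.mem_carrier[OF subgroup_P_sub] by simp
  qed
qed

section \<open>Orbit sizes\<close>

lemma finite_E: "finite E" and card_E: "card E = n"
  using bij_betw_finite[OF bij_pt] bij_betw_same_card[OF bij_pt] by simp_all

lemma card_pt_residues:
  assumes "r dvd n" "0 < r" "S \<subseteq> {0..<int r}"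
  shows "card {pt y |y. y mod int r \<in> S} = card S * (n div r)"
proof -
  let ?B = "{y \<in> {0..<int n}. y mod int r \<in> S}"
  have "{pt y |y. y mod int r \<in> S} = pt ` ?B"
  proof (intro equalityI subsetI)
    fix z assume "z \<in> {pt y |y. y mod int r \<in> S}"
    then obtain y where y: "z = pt y" "y mod int r \<in> S" by blast
    have "z = pt (y mod int n)" unfolding y(1) by (simp add: pt_eq_iff cong_def)
    moreover have "y mod int n \<in> ?B"
      using y(2) n_pos assms(1) by (simp add: mod_mod_cancel)
    ultimately show "z \<in> pt ` ?B" by blast
  qed auto
  moreover have "inj_on pt ?B"
    using bij_pt unfolding bij_betw_def by (rule inj_on_subset[OF conjunct1]) auto
  ultimately show ?thesis
    using card_residues_in[OF assms] by (simp add: card_image)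
qed

lemma sum_card_orbits:
  assumes "subgroup H G"
  shows "(\<Sum>orb\<in>orbits (G\<lparr>carrier := H\<rparr>) E \<phi>. card orb) = n"
    and "finite (orbits (G\<lparr>carrier := H\<rparr>) E \<phi>)"
proof -
  interpret H: group_action "G\<lparr>carrier := H\<rparr>" E \<phi> by (rule induced_action[OF assms])
  show "(\<Sum>orb\<in>orbits (G\<lparr>carrier := H\<rparr>) E \<phi>. card orb) = n"
    using H.disjoint_sum[OF finite_E, of "\<lambda>_. 1::nat"] by (simp add: card_E)
  have "orbits (G\<lparr>carrier := H\<rparr>) E \<phi> = orbit (G\<lparr>carrier := H\<rparr>) \<phi> ` E"
    unfolding orbits_def by blast
  then show "finite (orbits (G\<lparr>carrier := H\<rparr>) E \<phi>)" using finite_E by simp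
qed

lemma orbits_pt: "orbits (G\<lparr>carrier := H\<rparr>) E \<phi> = range (\<lambda>x. orbit (G\<lparr>carrier := H\<rparr>) \<phi> (pt x))"
  unfolding orbits_def E_eq by blast

text \<open>Since \<open>M(r)\<close> contains \<open>w [^] r\<close>, its orbits are unions of full
  residue classes modulo \<open>r\<close>, and \<open>a\<close> permutes these classes through
  multiplication by \<open>\<alpha>\<close>.\<close>

lemma orbit_M_sub:
  assumes "r dvd n"
  shows "orbit (G\<lparr>carrier := M_sub G a w r\<rparr>) \<phi> (pt x) =
    {pt y |y. y mod int r \<in> range (\<lambda>i::nat. \<alpha> ^ i * x mod int r)}"
proof (intro equalityI subsetI)
  fix z assume "z \<in> orbit (G\<lparr>carrier := M_sub G a w r\<rparr>) \<phi> (pt x)"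
  then obtain i j where "z = pt (\<alpha> ^ i * x + j)" "int r dvd j"
    unfolding orbit_pt[OF subgroup_M_sub] mem_M_sub[OF assms] by blast
  moreover from this(2) have "(\<alpha> ^ i * x + j) mod int r = \<alpha> ^ i * x mod int r"
    by (auto elim!: dvdE)
  ultimately show "z \<in> {pt y |y. y mod int r \<in> range (\<lambda>i::nat. \<alpha> ^ i * x mod int r)}"
    by blast
next
  fix z assume "z \<in> {pt y |y. y mod int r \<in> range (\<lambda>i::nat. \<alpha> ^ i * x mod int r)}"
  then obtain y i where "z = pt y" "y mod int r = \<alpha> ^ i * x mod int r" by blast
  then have "z = pt (\<alpha> ^ i * x + (y - \<alpha> ^ i * x))" "int r dvd y - \<alpha> ^ i * x"
    by (simp_all add: mod_eq_dvd_iff)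
  then show "z \<in> orbit (G\<lparr>carrier := M_sub G a w r\<rparr>) \<phi> (pt x)"
    unfolding orbit_pt[OF subgroup_M_sub] mem_M_sub[OF assms] by blast
qed

text \<open>
  All orbits except that of \<open>p\<close> have the same size, so their number follows from the total \<open>n\<close>.
\<close>

lemma orbit_sizes_M_sub:
  assumes r: "Factorial_Ring.prime r" "r dvd n"
  shows "ord_int r \<alpha> dvd r - 1"
    and "orbit_sizes G E \<phi> (M_sub G a w r) =
      replicate_mset ((r - 1) div ord_int r \<alpha>) (n * ord_int r \<alpha> div r) + {#n div r#}"
proof -
  let ?o = "ord_int r \<alpha>"
  let ?orb = "\<lambda>x. orbit (G\<lparr>carrier := M_sub G a w r\<rparr>) \<phi> (pt x)"
  define Orb where "Orb = orbits (G\<lparr>carrier := M_sub G a w r\<rparr>) E \<phi>"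
  have r0: "0 < r" using r(1) by (rule prime_gt_0_nat)
  have \<alpha>r: "coprime \<alpha> (int r)"
    using coprime_\<alpha> r(2) by (metis coprime_divisors dvd_refl int_dvd_int_iff)
  obtain m where m: "n = r * m" using r(2) ..
  then have m0: "0 < m" using n_pos by simp
  have nr: "n div r = m" "n * ?o div r = ?o * m" using r0 by (simp_all add: m)
  have card_orb: "card (?orb x) = card (range (\<lambda>i::nat. \<alpha> ^ i * x mod int r)) * m" for x
    unfolding orbit_M_sub[OF r(2)] nr(1)[symmetric]
    using r0 by (intro card_pt_residues[OF r(2)]) auto
  have zero: "range (\<lambda>i::nat. \<alpha> ^ i * x mod int r) = {0}" if "int r dvd x" for x
    using that by auto
  have orb0: "?orb x = ?orb 0" if "int r dvd x" for x
    unfolding orbit_M_sub[OF r(2)] zero[OF that] zero[OF dvd_0_right] ..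
  have card_orb0: "card (?orb 0) = m" unfolding card_orb by simp
  have card_other: "card B = ?o * m" if B: "B \<in> Orb - {?orb 0}" for B
  proof -
    obtain x where x: "B = ?orb x" using B unfolding Orb_def orbits_pt by blast
    with B have "?orb x \<noteq> ?orb 0" by simp
    with orb0 have "\<not> int r dvd x" by blast
    then show ?thesis
      unfolding x card_orb using card_power_orbit_mod_prime(1)[OF r(1) \<alpha>r] by simp
  qed
  \<comment> \<open>Positivity comes from a lemma about a residue not divisible by \<open>r\<close>;
    1 is such a residue.\<close>
  have o_pos: "0 < ?o"
  proof (rule card_power_orbit_mod_prime(2)[OF r(1) \<alpha>r])
    show "\<not> int r dvd 1" using prime_gt_1_nat[OF r(1)] by simp
  qed
  have fin: "finite Orb" unfolding Orb_def by (rule sum_card_orbits(2)[OF subgroup_M_sub])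
  have mem0: "?orb 0 \<in> Orb" unfolding Orb_def orbits_pt by blast
  let ?N = "card (Orb - {?orb 0})"
  have "n = card (?orb 0) + (\<Sum>B\<in>Orb - {?orb 0}. card B)"
    unfolding sum_card_orbits(1)[OF subgroup_M_sub, of r, symmetric] Orb_def[symmetric]
    by (rule sum.remove[OF fin mem0])
  also have "\<dots> = m + ?N * (?o * m)" using card_other card_orb0 by simp
  \<comment> \<open>Cancelling \<open>m\<close> in this count of points gives both the divisibility
    and the number of orbits.\<close>
  finally have "r * m = (1 + ?N * ?o) * m" by (simp add: m algebra_simps)
  then have "r = 1 + ?N * ?o" using m0 by (metis mult_cancel2 less_irrefl)
  then have N: "r - 1 = ?N * ?o" by simp
  then show "?o dvd r - 1" by simp
  have "mset_set Orb = add_mset (?orb 0) (mset_set (Orb - {?orb 0}))"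
    using fin mem0 by (simp add: mset_set.remove)
  then have "orbit_sizes G E \<phi> (M_sub G a w r) =
      add_mset m (image_mset card (mset_set (Orb - {?orb 0})))"
    unfolding orbit_sizes_def Orb_def[symmetric] by (simp add: card_orb0)
  also have "image_mset card (mset_set (Orb - {?orb 0})) = replicate_mset ?N (?o * m)"
    using card_other fin by (subst image_mset_cong[where g = "\<lambda>_. ?o * m"]) (auto simp: image_mset_const_eq)
  also have "?N = (r - 1) div ?o" using N o_pos by simp
  finally show "orbit_sizes G E \<phi> (M_sub G a w r) =
      replicate_mset ((r - 1) div ?o) (n * ?o div r) + {#n div r#}"
    unfolding nr by simp
qed

text \<open>Modulo 4, \<open>P\<close> acts through \<open>x \<mapsto> x\<close> and
  \<open>x \<mapsto> 1 - x\<close>, and \<open>w [^] 4\<close> fills out whole residue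
  classes.\<close>

lemma orbit_P_sub:
  assumes neg: "negative_aut n \<alpha>"
  shows "orbit (G\<lparr>carrier := P_sub G a w\<rparr>) \<phi> (pt x) =
    {pt y |y. y mod int 4 \<in> {x mod 4, (1 - x) mod 4}}"
proof (intro equalityI subsetI)
  have \<alpha>4: "[\<alpha> ^ i = (if odd i then -1 else 1)] (mod 4)" for i
    using neg by (intro pow_minus_one_cong) (simp add: negative_aut_def)
  fix z assume "z \<in> orbit (G\<lparr>carrier := P_sub G a w\<rparr>) \<phi> (pt x)"
  then obtain i j where z: "z = pt (\<alpha> ^ i * x + j)" "[j = of_bool (odd i)] (mod 4)"
    unfolding orbit_pt[OF subgroup_P_sub] mem_P_sub[OF neg] by blast
  have "[\<alpha> ^ i * x + j = (if odd i then -1 else 1) * x + of_bool (odd i)] (mod 4)"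
    by (intro cong_add cong_mult cong_refl \<alpha>4 z)
  then have "(\<alpha> ^ i * x + j) mod 4 \<in> {x mod 4, (1 - x) mod 4}"
    by (cases "odd i") (simp_all add: cong_def)
  then show "z \<in> {pt y |y. y mod int 4 \<in> {x mod 4, (1 - x) mod 4}}"
    using z(1) by auto
next
  have \<alpha>4: "[\<alpha> = -1] (mod 4)" using neg by (simp add: negative_aut_def)
  fix z assume "z \<in> {pt y |y. y mod int 4 \<in> {x mod 4, (1 - x) mod 4}}"
  then obtain y where y: "z = pt y" "y mod 4 = x mod 4 \<or> y mod 4 = (1 - x) mod 4" by auto
  from y(2) have "\<exists>i::nat. [y - \<alpha> ^ i * x = of_bool (odd i)] (mod 4)"
  proof
    assume "y mod 4 = x mod 4"
    then have "[y - \<alpha> ^ 0 * x = of_bool (odd (0::nat))] (mod 4)"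
      by (simp add: cong_iff_dvd_diff mod_eq_dvd_iff)
    then show ?thesis ..
  next
    assume y': "y mod 4 = (1 - x) mod 4"
    have "[\<alpha> * x = -1 * x] (mod 4)" using \<alpha>4 by (rule cong_mult[OF _ cong_refl])
    with y' have "[y - \<alpha> * x = (1 - x) - -1 * x] (mod 4)"
      by (intro cong_diff) (simp_all add: cong_def)
    then have "[y - \<alpha> ^ 1 * x = of_bool (odd (1::nat))] (mod 4)" by simp
    then show ?thesis ..
  qed
  then obtain i :: nat where "[y - \<alpha> ^ i * x = of_bool (odd i)] (mod 4)" ..
  moreover have "z = pt (\<alpha> ^ i * x + (y - \<alpha> ^ i * x))" by (simp add: y(1))
  ultimately show "z \<in> orbit (G\<lparr>carrier := P_sub G a w\<rparr>) \<phi> (pt x)"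
    unfolding orbit_pt[OF subgroup_P_sub] mem_P_sub[OF neg] by blast
qed

text \<open>\<open>x\<close> and \<open>1 - x\<close> have different parity, so every orbit consists
  of exactly two residue classes modulo 4 and contains half of the points.\<close>

lemma orbit_sizes_P_sub:
  assumes neg: "negative_aut n \<alpha>"
  shows "orbit_sizes G E \<phi> (P_sub G a w) = {#n div 2, n div 2#}"
proof -
  define Orb where "Orb = orbits (G\<lparr>carrier := P_sub G a w\<rparr>) E \<phi>"
  have n4: "4 dvd n" using neg by (simp add: negative_aut_def)
  then obtain m where m: "n = 4 * m" ..
  then have m0: "0 < m" using n_pos by simp
  have card: "card B = 2 * m" if "B \<in> Orb" for B
  proof -
    obtain x where x: "B = orbit (G\<lparr>carrier := P_sub G a w\<rparr>) \<phi> (pt x)"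
      using \<open>B \<in> Orb\<close> unfolding Orb_def orbits_pt by blast
    have "x mod 4 \<noteq> (1 - x) mod 4"
    proof
      assume "x mod 4 = (1 - x) mod 4"
      then have "4 dvd x - (1 - x)" by (simp only: mod_eq_dvd_iff)
      then have "even (x - (1 - x))" by (rule dvd_trans[rotated]) simp
      then show False by simp
    qed
    then have "card {x mod 4, (1 - x) mod 4} = 2" by simp
    moreover have "{x mod 4, (1 - x) mod 4} \<subseteq> {0..<int 4}" by simp
    ultimately show ?thesis
      unfolding x orbit_P_sub[OF neg]
      using card_pt_residues[OF n4, of "{x mod 4, (1 - x) mod 4}"] by (simp add: m)
  qed
  have fin: "finite Orb" unfolding Orb_def by (rule sum_card_orbits(2)[OF subgroup_P_sub])
  have "n = (\<Sum>B\<in>Orb. card B)"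
    unfolding Orb_def by (rule sum_card_orbits(1)[OF subgroup_P_sub, symmetric])
  also have "\<dots> = card Orb * (2 * m)" using card by simp
  finally have "card Orb = 2" using m0 by (simp add: m)
  moreover have "image_mset card (mset_set Orb) = replicate_mset (card Orb) (2 * m)"
    using card fin by (subst image_mset_cong[where g = "\<lambda>_. 2 * m"]) (auto simp: image_mset_const_eq)
  moreover have "n div 2 = 2 * m" by (simp add: m)
  ultimately show ?thesis
    unfolding orbit_sizes_def Orb_def[symmetric] by (simp add: numeral_2_eq_2)
qed

section \<open>Maximality and classification\<close>

lemma family_maximal:
  assumes "K \<in> standard_family"
  shows "maximal_intransitive G E \<phi> K"
  by (rule maximal_intransitive_family[OF finite_carrier _ _ _ assms])
    (fact family_intransitive family_covering family_separated)+

lemma conjugate_in_family: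
  assumes "maximal_intransitive G E \<phi> H"
  shows "\<exists>!K. K \<in> standard_family \<and> conjugate_in G H K"
  by (rule maximal_intransitive_conjugate_in_family[OF finite_carrier _ _ _ assms])
    (fact family_intransitive family_covering family_separated)+

text \<open>Uniqueness of the conjugate subgroup within the family becomes a statement about
  parameters, because the primes give distinct \<open>M(r)\<close>, all different from
  \<open>P\<close>.\<close>

lemma classification:
  assumes "maximal_intransitive G E \<phi> H"
  shows "((\<exists>!r. Factorial_Ring.prime r \<and> r dvd n \<and> conjugate_in G H (M_sub G a w r)) \<and>
       \<not> (negative_aut n \<alpha> \<and> conjugate_in G H (P_sub G a w))) \<or>
    ((negative_aut n \<alpha> \<and> conjugate_in G H (P_sub G a w)) \<and>
       \<not> (\<exists>r. Factorial_Ring.prime r \<and> r dvd n \<and> conjugate_in G H (M_sub G a w r)))"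
proof -
  obtain K where K: "K \<in> standard_family" "conjugate_in G H K"
    and unique: "\<And>L. L \<in> standard_family \<Longrightarrow> conjugate_in G H L \<Longrightarrow> L = K"
    using conjugate_in_family[OF assms] by blast
  have M: "M_sub G a w r = K" if "Factorial_Ring.prime r" "r dvd n" "conjugate_in G H (M_sub G a w r)" for r
    using that by (intro unique M_sub_in_family P_sub_in_family)
  have P: "P_sub G a w = K" if "negative_aut n \<alpha>" "conjugate_in G H (P_sub G a w)"
    using that by (intro unique M_sub_in_family P_sub_in_family)
  from K(1) consider
    r where "Factorial_Ring.prime r" "r dvd n" "K = M_sub G a w r"
    | "negative_aut n \<alpha>" "K = P_sub G a w"
    unfolding standard_family_def by (auto split: if_splits)
  then show ?thesis
  proof cases
    case (1 r)
    have "\<exists>!r. Factorial_Ring.prime r \<and> r dvd n \<and> conjugate_in G H (M_sub G a w r)"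
    proof (rule ex1I)
      show "Factorial_Ring.prime r \<and> r dvd n \<and> conjugate_in G H (M_sub G a w r)"
        using 1 K(2) by simp
      fix s assume s: "Factorial_Ring.prime s \<and> s dvd n \<and> conjugate_in G H (M_sub G a w s)"
      then have "M_sub G a w s = M_sub G a w r" using M 1(3) by blast
      with s 1(1,2) show "s = r" by (intro M_sub_inj) simp_all
    qed
    moreover have "\<not> (negative_aut n \<alpha> \<and> conjugate_in G H (P_sub G a w))"
      using P 1(3) M_sub_neq_P_sub[OF 1(1,2)] by blast
    ultimately show ?thesis by blast
  next
    case 2
    then have "negative_aut n \<alpha> \<and> conjugate_in G H (P_sub G a w)" using K(2) by simp
    moreover have "\<not> (\<exists>r. Factorial_Ring.prime r \<and> r dvd n \<and> conjugate_in G H (M_sub G a w r))"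
      using M 2 M_sub_neq_P_sub by blast
    ultimately show ?thesis by blast
  qed
qed

end

theorem theorem2:
  fixes G :: "('a, 'c) monoid_scheme" (structure)
    and E :: "'b set" and \<phi> :: "'a \<Rightarrow> 'b \<Rightarrow> 'b"
    and a w :: 'a and p :: 'b and W A :: "'a set" and n :: nat and \<alpha> :: int
  assumes "faithful_action G E \<phi>"
    and "finite (carrier G)"
    and "a \<in> carrier G" and "w \<in> carrier G"
    and "carrier G = generate G {a, w}"
    and "W = generate G {w}" and "W \<lhd> G" and "regular_subgroup G E \<phi> W"
    and "n = card W"
    and "A = generate G {a}" and "p \<in> E" and "A = stabilizer G \<phi> p"
    and "inv a \<otimes> w \<otimes> a = w [^] \<alpha>"
  shows
    "(\<forall>r. Factorial_Ring.prime r \<and> r dvd n \<longrightarrow> maximal_intransitive G E \<phi> (M_sub G a w r)) \<and>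
     (negative_aut n \<alpha> \<longrightarrow> maximal_intransitive G E \<phi> (P_sub G a w)) \<and>
     (\<forall>H. maximal_intransitive G E \<phi> H \<longrightarrow>
        ((\<exists>!r. Factorial_Ring.prime r \<and> r dvd n \<and> conjugate_in G H (M_sub G a w r)) \<and>
           \<not> (negative_aut n \<alpha> \<and> conjugate_in G H (P_sub G a w))) \<or>
        ((negative_aut n \<alpha> \<and> conjugate_in G H (P_sub G a w)) \<and>
           \<not> (\<exists>r. Factorial_Ring.prime r \<and> r dvd n \<and> conjugate_in G H (M_sub G a w r)))) \<and>
     (\<forall>r. Factorial_Ring.prime r \<and> r dvd n \<longrightarrow>
        ord_int r \<alpha> dvd r - 1 \<and>
        orbit_sizes G E \<phi> (M_sub G a w r) =
          replicate_mset ((r - 1) div ord_int r \<alpha>) (n * ord_int r \<alpha> div r) + {#n div r#}) \<and>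
     (negative_aut n \<alpha> \<longrightarrow>
        orbit_sizes G E \<phi> (P_sub G a w) = {#n div 2, n div 2#})"
proof -
  interpret faithful_action G E \<phi> by fact
  interpret cyclic_regular G E \<phi> a w p W n \<alpha>
    using assms by unfold_locales auto
  show ?thesis
  proof (intro conjI allI impI)
    fix r assume r: "Factorial_Ring.prime r \<and> r dvd n"
    then show "maximal_intransitive G E \<phi> (M_sub G a w r)"
      by (intro family_maximal M_sub_in_family) simp_all
    show "ord_int r \<alpha> dvd r - 1"
      "orbit_sizes G E \<phi> (M_sub G a w r) =
        replicate_mset ((r - 1) div ord_int r \<alpha>) (n * ord_int r \<alpha> div r) + {#n div r#}"
      using r orbit_sizes_M_sub by blast+
  next
    assume "negative_aut n \<alpha>"
    then show "maximal_intransitive G E \<phi> (P_sub G a w)"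
      "orbit_sizes G E \<phi> (P_sub G a w) = {#n div 2, n div 2#}"
      by (auto intro: family_maximal P_sub_in_family orbit_sizes_P_sub)
  qed (rule classification)
qed

end
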